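(* Let $f\colon X\to Y$ be a perfect $n$-dimensional map between metrizable spaces with $\dim Y=0$, and let $m\geq 2n+1$. Then the set of all maps $g\in C(X,\mathbb R^m)$ such that $\dim P_{2,1,m}(g|f^{-1}(y),z)\leq 0$ for all $y\in Y$ and all $z\in\mathbb R^m\setminus g(f^{-1}(y))$ is a dense $G_\delta$-subset of $C(X,\mathbb R^m)$ equipped with the source limitation topology.
   Context: All spaces are metrizable and all single-valued maps are continuous; $\dim$ is covering dimension. A perfect map is a closed continuous map with compact fibers; the map $f$ is $n$-dimensional if $\dim f=\sup\{\dim f^{-1}(y):y\in Y\}=n$. $C(X,\mathbb R^m)$ is the set of all continuous maps $X\to\mathbb R^m$. The source limitation topology on $C(X,M)$, for a metric space $(M,\rho)$, is the topology in which a neighborhood base at $h\in C(X,M)$ consists of the sets $B_\rho(h,\epsilon)=\{g\in C(X,M):\rho(g(x),h(x))<\epsilon(x)\ \text{for all}\ x\in X\}$, where $\epsilon\colon X\to(0,1]$ runs over all continuous positive functions. $M_{m,d}$ denotes the space of all $d$-dimensional (affine) planes in $\mathbb R^m$, with its standard metrizable topology. For a map $g$ from a space $Z$ into $\mathbb R^m$ and a point $z\notin g(Z)$, $P_{2,1,m}(g,z)$ is the subspace of $M_{m,1}$ consisting of all lines $\Pi^1\subset\mathbb R^m$ with $z\in\Pi^1$ and $|g^{-1}(\Pi^1)|\geq 2$. Here this is applied to the restriction $g|f^{-1}(y)\colon f^{-1}(y)\to\mathbb R^m$. *)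

theory Defs
  imports "HOL-Analysis.Analysis"
begin

section \<open>Covering dimension\<close>

text \<open>The relation \<open>dim_le\<close> of the library is the small inductive dimension, so the covering
  dimension is defined here, by finite open covers. The multiplicity bound \<open>n + 1\<close> makes
  \<open>n = -1\<close> characterise the empty space.\<close>

definition covering_dim_le :: "'a topology \<Rightarrow> int \<Rightarrow> bool" where
  "covering_dim_le X n \<longleftrightarrow> -1 \<le> n \<and>
     (\<forall>\<U>. finite \<U> \<and> (\<forall>U\<in>\<U>. openin X U) \<and> \<Union>\<U> = topspace X \<longrightarrow>
        (\<exists>\<V>. finite \<V> \<and> (\<forall>V\<in>\<V>. openin X V) \<and> \<Union>\<V> = topspace X \<and>
             (\<forall>V\<in>\<V>. \<exists>U\<in>\<U>. V \<subseteq> U) \<and>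
             (\<forall>x\<in>topspace X. int (card {V\<in>\<V>. x \<in> V}) \<le> n + 1)))"

definition covering_dim :: "'a topology \<Rightarrow> ereal" where
  "covering_dim X = (INF n\<in>{n. covering_dim_le X n}. ereal (real_of_int n))"

lemma covering_dim_le_mono:
  assumes "covering_dim_le X n" "n \<le> k"
  shows "covering_dim_le X k"
  using assms unfolding covering_dim_le_def
  by (smt (verit, ccfv_SIG))

lemma covering_dim_le_iff:
  assumes "-1 \<le> n"
  shows "covering_dim X \<le> ereal (real_of_int n) \<longleftrightarrow> covering_dim_le X n"
proof
  assume "covering_dim_le X n"
  then show "covering_dim X \<le> ereal (real_of_int n)"
    unfolding covering_dim_def by (intro INF_lower) auto
next
  assume "covering_dim X \<le> ereal (real_of_int n)"
  then have "covering_dim X < ereal (real_of_int n + 1)"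
    by (rule le_less_trans) simp
  then obtain k where "covering_dim_le X k" "real_of_int k < real_of_int n + 1"
    unfolding covering_dim_def by (auto simp: INF_less_iff)
  then show "covering_dim_le X n"
    using covering_dim_le_mono[of X k n] by linarith
qed

definition map_dim :: "'a topology \<Rightarrow> 'b topology \<Rightarrow> ('a \<Rightarrow> 'b) \<Rightarrow> ereal" where
  "map_dim X Y f =
     (SUP y\<in>topspace Y. covering_dim (subtopology X {x \<in> topspace X. f x = y}))"

section \<open>The source limitation topology\<close>

text \<open>Maps are taken to be \<open>undefined\<close> outside the space, so that two maps are equal
  iff they agree on the space.\<close>

definition maps_into :: "'a topology \<Rightarrow> ('a \<Rightarrow> 'b::metric_space) set" where
  "maps_into X = {g \<in> extensional (topspace X). continuous_map X euclidean g}"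

definition source_ball ::
    "'a topology \<Rightarrow> ('a \<Rightarrow> 'b::metric_space) \<Rightarrow> ('a \<Rightarrow> real) \<Rightarrow> ('a \<Rightarrow> 'b) set" where
  "source_ball X h \<epsilon> = {g \<in> maps_into X. \<forall>x\<in>topspace X. dist (g x) (h x) < \<epsilon> x}"

definition gauge_fun :: "'a topology \<Rightarrow> ('a \<Rightarrow> real) \<Rightarrow> bool" where
  "gauge_fun X \<epsilon> \<longleftrightarrow>
     continuous_map X euclideanreal \<epsilon> \<and> (\<forall>x\<in>topspace X. 0 < \<epsilon> x \<and> \<epsilon> x \<le> 1)"

definition source_limitation_topology ::
    "'a topology \<Rightarrow> ('a \<Rightarrow> 'b::metric_space) topology" where
  "source_limitation_topology X = topology (\<lambda>U. U \<subseteq> maps_into X \<and>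
     (\<forall>h\<in>U. \<exists>\<epsilon>. gauge_fun X \<epsilon> \<and> source_ball X h \<epsilon> \<subseteq> U))"

lemma openin_source_limitation_topology:
  "openin (source_limitation_topology X) U \<longleftrightarrow> U \<subseteq> maps_into X \<and>
     (\<forall>h\<in>U. \<exists>\<epsilon>. gauge_fun X \<epsilon> \<and> source_ball X h \<epsilon> \<subseteq> U)"
proof -
  let ?P = "\<lambda>U::('a \<Rightarrow> 'b) set. U \<subseteq> maps_into X \<and>
     (\<forall>h\<in>U. \<exists>\<epsilon>. gauge_fun X \<epsilon> \<and> source_ball X h \<epsilon> \<subseteq> U)"
  have "?P (U \<inter> V)" if U: "?P U" and V: "?P V" for U V
  proof (intro conjI ballI)
    show "U \<inter> V \<subseteq> maps_into X" using U by blast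
    fix h assume h: "h \<in> U \<inter> V"
    obtain \<epsilon> where e: "gauge_fun X \<epsilon>" "source_ball X h \<epsilon> \<subseteq> U" using U h by blast
    obtain \<delta> where d: "gauge_fun X \<delta>" "source_ball X h \<delta> \<subseteq> V" using V h by blast
    have "gauge_fun X (\<lambda>x. min (\<epsilon> x) (\<delta> x))"
      using e d by (auto simp: gauge_fun_def intro: continuous_map_real_min)
    moreover have "source_ball X h (\<lambda>x. min (\<epsilon> x) (\<delta> x)) \<subseteq> U \<inter> V"
      using e d by (auto simp: source_ball_def)
    ultimately show "\<exists>\<epsilon>. gauge_fun X \<epsilon> \<and> source_ball X h \<epsilon> \<subseteq> U \<inter> V" by blast
  qed
  moreover have "?P (\<Union>\<K>)" if "\<forall>K\<in>\<K>. ?P K" for \<K>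
    using that by (meson Sup_least UnionE Union_upper subset_trans)
  ultimately have "istopology ?P" unfolding istopology_def by blast
  then show ?thesis
    by (simp add: source_limitation_topology_def topology_inverse')
qed

lemma gauge_fun_one: "gauge_fun X (\<lambda>x. 1)"
  by (simp add: gauge_fun_def)

lemma topspace_source_limitation_topology [simp]:
  "topspace (source_limitation_topology X) = maps_into X"
proof -
  have "openin (source_limitation_topology X) (maps_into X)"
    using gauge_fun_one by (auto simp: openin_source_limitation_topology source_ball_def)
  then show ?thesis
    by (metis openin_source_limitation_topology openin_subset openin_topspace subset_antisym)
qed

lemma openin_source_ball:
  assumes "h \<in> maps_into X" "gauge_fun X \<epsilon>"
  shows "openin (source_limitation_topology X) (source_ball X h \<epsilon>)"
  unfolding openin_source_limitation_topology
proof (intro conjI ballI)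
  show "source_ball X h \<epsilon> \<subseteq> maps_into X" by (auto simp: source_ball_def)
  fix g assume g: "g \<in> source_ball X h \<epsilon>"
  have c: "continuous_map X euclidean g" "continuous_map X euclidean h"
    using g assms by (auto simp: source_ball_def maps_into_def)
  have "continuous_map X (prod_topology euclidean euclidean) (\<lambda>x. (g x, h x))"
    using c by (rule continuous_map_pairedI)
  moreover have "continuous_map (prod_topology euclidean euclidean) euclideanreal
      (\<lambda>p::'b \<times> 'b. dist (fst p) (snd p))"
    by (auto intro!: continuous_intros)
  ultimately have "continuous_map X euclideanreal
      ((\<lambda>p. dist (fst p) (snd p)) \<circ> (\<lambda>x. (g x, h x)))"
    by (rule continuous_map_compose)
  then have d: "continuous_map X euclideanreal (\<lambda>x. dist (g x) (h x))"
    by (simp add: o_def)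
  have "0 < \<epsilon> x - dist (g x) (h x) \<and> \<epsilon> x - dist (g x) (h x) \<le> 1" if "x \<in> topspace X" for x
  proof -
    have "dist (g x) (h x) < \<epsilon> x" "\<epsilon> x \<le> 1"
      using that g assms by (auto simp: gauge_fun_def source_ball_def)
    then show ?thesis using zero_le_dist[of "g x" "h x"] by linarith
  qed
  then have "gauge_fun X (\<lambda>x. \<epsilon> x - dist (g x) (h x))"
    using d assms by (auto simp: gauge_fun_def intro!: continuous_map_diff)
  moreover have "source_ball X g (\<lambda>x. \<epsilon> x - dist (g x) (h x)) \<subseteq> source_ball X h \<epsilon>"
  proof
    fix k assume "k \<in> source_ball X g (\<lambda>x. \<epsilon> x - dist (g x) (h x))"
    then have "k \<in> maps_into X" "\<forall>x\<in>topspace X. dist (k x) (g x) + dist (g x) (h x) < \<epsilon> x"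
      by (auto simp: source_ball_def less_diff_eq)
    then show "k \<in> source_ball X h \<epsilon>"
      by (auto simp: source_ball_def intro: le_less_trans[OF dist_triangle])
  qed
  ultimately show "\<exists>\<delta>. gauge_fun X \<delta> \<and> source_ball X g \<delta> \<subseteq> source_ball X h \<epsilon>" by blast
qed

section \<open>The space of lines\<close>

definition lines :: "('v::euclidean_space) set set" where
  "lines = {L. affine L \<and> aff_dim L = 1}"

text \<open>The topology is the quotient topology under the map that sends a pair of distinct points
  to the line through them; the set of such pairs is open in the square of the space.\<close>

definition line_topology :: "('v::euclidean_space) set topology" where
  "line_topology = topology (\<lambda>\<L>. \<L> \<subseteq> lines \<and>
     open {(a, b). a \<noteq> b \<and> affine hull {a, b} \<in> \<L>})"

lemma openin_line_topology:
  "openin line_topology \<L> \<longleftrightarrow> \<L> \<subseteq> lines \<and> open {(a, b). a \<noteq> b \<and> affine hull {a, b} \<in> \<L>}"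
proof -
  let ?Q = "\<lambda>\<L>::'a set set. {(a, b). a \<noteq> b \<and> affine hull {a, b} \<in> \<L>}"
  have 1: "?Q (S \<inter> T) = ?Q S \<inter> ?Q T" for S T by auto
  have 2: "?Q (\<Union>\<K>) = (\<Union>K\<in>\<K>. ?Q K)" for \<K> by auto
  have "istopology (\<lambda>\<L>::'a set set. \<L> \<subseteq> lines \<and> open (?Q \<L>))"
    unfolding istopology_def 1 2 by (auto intro!: open_Int open_UN)
  then show ?thesis
    by (simp add: line_topology_def topology_inverse')
qed

lemma line_through_in_lines: "a \<noteq> b \<Longrightarrow> affine hull {a, b} \<in> lines"
  by (simp add: lines_def aff_dim_2)

lemma topspace_line_topology [simp]: "topspace line_topology = lines"
proof -
  have "{(a, b). a \<noteq> b \<and> affine hull {a, b} \<in> lines} = {p::'a \<times> 'a. fst p \<noteq> snd p}"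
    by (auto simp: line_through_in_lines)
  moreover have "open {p::'a \<times> 'a. fst p \<noteq> snd p}"
    by (intro open_Collect_neq continuous_intros)
  ultimately have "openin line_topology (lines :: 'a set set)"
    by (simp add: openin_line_topology)
  then show ?thesis
    by (metis openin_line_topology openin_subset openin_topspace subset_antisym)
qed

text \<open>\<open>secant_lines Z g z\<close> is the set \<open>P\<^sub>2\<^sub>,\<^sub>1\<^sub>,\<^sub>m(g|Z, z)\<close> of the lines through \<open>z\<close> whose preimage
  under \<open>g|Z\<close> has at least two points. As \<open>card\<close> is 0 on infinite sets, infinite preimages
  are listed separately.\<close>

definition secant_lines :: "'a set \<Rightarrow> ('a \<Rightarrow> 'v::euclidean_space) \<Rightarrow> 'v \<Rightarrow> 'v set set" where
  "secant_lines Z g z = {L \<in> lines. z \<in> L \<and>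
     (infinite {x \<in> Z. g x \<in> L} \<or> 2 \<le> card {x \<in> Z. g x \<in> L})}"

end

theory Submission
  imports Defs
begin

text \<open>The lines through \<open>z\<close> are encoded by their unit directions \<open>u\<close>. For a fibre \<open>K\<close>, a scale \<open>e\<close> and
  a point \<open>z\<close>, the directions of the lines through \<open>z\<close> that meet \<open>g\<close> in two points of \<open>K\<close> at distance
  at least \<open>e\<close>, with values at distance at least \<open>e\<close> from \<open>z\<close>, form a compact set. The space of secant
  lines is the union of the images of these sets for \<open>e = 1/(k+1)\<close>, so by the countable closed sum
  theorem it is zero-dimensional iff none of them contains a connected set with two points. By
  compactness, containing a connected set of diameter at least \<open>e\<close> is stable under limits of \<open>g\<close>, of
  \<open>z\<close> and of the base point of the fibre, since \<open>f\<close> is perfect. This makes the set of good maps a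
  \<open>G\<^sub>\<delta>\<close> set.

  For the density, a map on a single fibre is approximated by the barycentric map of a fine cover of
  order \<open>n + 1\<close> whose vertices are in general position: two points at distance at least \<open>e\<close> have
  disjoint carriers with at most \<open>2 n + 2 \<le> m + 1\<close> vertices altogether, so that \<open>z\<close> lies on at most one
  line meeting both carriers, and only finitely many secants remain. As \<open>dim Y = 0\<close>, such
  approximations near the fibres can be glued along a disjoint open cover of \<open>Y\<close>, and a Baire category
  argument in the source limitation topology finishes the proof.\<close>

subsection \<open>Zero-dimensional spaces\<close>

text \<open>The goal quantifies over uncountably many fibres and points \<open>z\<close>, so each
  bad configuration must be caught at a scale where it is a closed condition and all its data stay
  in compact sets. One number \<open>e\<close> does this: the two preimages are at least
  \<open>e\<close> apart, their values at least \<open>e\<close> from \<open>z\<close>, the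
  connected set of directions has two points at distance at least \<open>e\<close>, and
  \<open>norm z \<le> 1/e\<close>. All these bounds relax as \<open>e\<close> decreases, so
  countably many scales suffice.

  A good map promises nothing for \<open>z\<close> on the image, so for the G-delta part only
  \<open>z\<close> with a definite distance from the graph are tested. Density is proved for a
  stronger condition that tests every \<open>z\<close>: it is open, the barycentric maps satisfy it
  on their fibre, and no distance from the image has to be tracked.

  Local approximations cannot be averaged by a partition of unity, since convex combinations need
  not keep the number of secants small. They are selected by a locally constant function on
  \<open>Y\<close> instead, and this is where \<open>dim Y = 0\<close> enters.\<close>

definition clopen_separated :: "'a topology \<Rightarrow> bool" where
  "clopen_separated X \<longleftrightarrow> (\<forall>A B. closedin X A \<and> closedin X B \<and> disjnt A B \<longrightarrow>
     (\<exists>C. openin X C \<and> closedin X C \<and> A \<subseteq> C \<and> disjnt B C))"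

lemma clopen_separatedD:
  assumes "clopen_separated X" "closedin X A" "closedin X B" "disjnt A B"
  obtains C where "openin X C" "closedin X C" "A \<subseteq> C" "disjnt B C"
  using assms unfolding clopen_separated_def by metis

lemma covering_dim_le_0_imp_clopen_separated:
  assumes "covering_dim_le X 0"
  shows "clopen_separated X"
  unfolding clopen_separated_def
proof (intro allI impI, elim conjE)
  fix A B assume A: "closedin X A" and B: "closedin X B" and AB: "disjnt A B"
  let ?U = "{topspace X - A, topspace X - B}"
  have "finite ?U \<and> (\<forall>U\<in>?U. openin X U) \<and> \<Union>?U = topspace X"
    using A B AB by (auto simp: disjnt_def)
  then obtain \<V> where *: "finite \<V> \<and> (\<forall>V\<in>\<V>. openin X V) \<and> \<Union>\<V> = topspace X \<and>
      (\<forall>V\<in>\<V>. \<exists>U\<in>?U. V \<subseteq> U) \<and> (\<forall>x\<in>topspace X. int (card {V\<in>\<V>. x \<in> V}) \<le> 0 + 1)"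
    using assms unfolding covering_dim_le_def by presburger
  have V: "finite \<V>" "\<And>V. V\<in>\<V> \<Longrightarrow> openin X V" "\<Union>\<V> = topspace X"
     "\<And>V. V\<in>\<V> \<Longrightarrow> \<exists>U\<in>?U. V \<subseteq> U" "\<And>x. x\<in>topspace X \<Longrightarrow> int (card {V\<in>\<V>. x \<in> V}) \<le> 0 + 1"
    using * by meson+
  have uniq: "V = W" if "V \<in> \<V>" "W \<in> \<V>" "x \<in> V" "x \<in> W" for x V W
  proof (rule ccontr)
    assume "V \<noteq> W"
    then have "card {V,W} \<le> card {V\<in>\<V>. x \<in> V}"
      using that V(1) by (intro card_mono) auto
    moreover have "x \<in> topspace X" using that V(3) by blast
    ultimately show False using V(5)[of x] \<open>V \<noteq> W\<close> by simp
  qed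
  \<comment> \<open>By \<open>uniq\<close> the refinement is a partition, so unions of its members
    are clopen. A member that meets \<open>A\<close> is not inside the complement of
    \<open>A\<close>, hence it misses \<open>B\<close>.\<close>
  define C where "C = \<Union>{V\<in>\<V>. V \<inter> A \<noteq> {}}"
  have eq: "topspace X - C = \<Union>{V\<in>\<V>. V \<inter> A = {}}"
    unfolding C_def V(3)[symmetric] using uniq by fastforce
  have "openin X C" "openin X (topspace X - C)"
    unfolding eq unfolding C_def using V(2) by auto
  moreover have "A \<subseteq> C"
    using closedin_subset[OF A] V(3) unfolding C_def by blast
  moreover have "disjnt B C"
    unfolding C_def disjnt_def using V(4) by fastforce
  ultimately show "\<exists>C. openin X C \<and> closedin X C \<and> A \<subseteq> C \<and> disjnt B C"
    by (metis closedin_def openin_subset)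
qed

text \<open>Induction on the cover: a clopen \<open>C\<close> takes from \<open>Z\<close> all that
  only \<open>U\<close> covers and stays inside \<open>U\<close>, and the rest \<open>Z - C\<close>
  is covered by the other members. The statement is relative to a clopen \<open>Z\<close> so that
  the hypothesis applies to this rest.\<close>

lemma clopen_separated_refine:
  assumes X: "clopen_separated X" and "finite \<U>" "\<And>U. U \<in> \<U> \<Longrightarrow> openin X U"
    and "openin X Z" "closedin X Z" "Z \<subseteq> \<Union>\<U>"
  shows "\<exists>\<V>. finite \<V> \<and> (\<forall>V\<in>\<V>. openin X V) \<and> \<Union>\<V> = Z \<and> (\<forall>V\<in>\<V>. \<exists>U\<in>\<U>. V \<subseteq> U) \<and>
    disjoint \<V>"
  using assms(2-)
proof (induction \<U> arbitrary: Z)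
  case empty
  then show ?case by (intro exI[of _ "{}"]) auto
next
  case (insert U \<U>)
  have "closedin X (Z - \<Union>\<U>)" "closedin X (Z - U)"
    using insert.prems by (auto intro!: closedin_diff)
  moreover have "disjnt (Z - \<Union>\<U>) (Z - U)"
    using insert.prems by (auto simp: disjnt_def)
  ultimately obtain C where C: "openin X C" "closedin X C" "Z - \<Union>\<U> \<subseteq> C" "disjnt (Z - U) C"
    using clopen_separatedD[OF X] by metis
  have "openin X (Z - C)" "closedin X (Z - C)" "Z - C \<subseteq> \<Union>\<U>"
    using C insert.prems by (auto intro: openin_diff closedin_diff)
  then obtain \<V> where V: "finite \<V>" "\<forall>V\<in>\<V>. openin X V" "\<Union>\<V> = Z - C" "\<forall>V\<in>\<V>. \<exists>U\<in>\<U>. V \<subseteq> U"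
    "disjoint \<V>"
    using insert.IH[of "Z - C"] insert.prems by auto
  show ?case
  proof (intro exI[of _ "insert (Z \<inter> C) \<V>"] conjI)
    show "\<forall>V\<in>insert (Z \<inter> C) \<V>. openin X V"
      using V C insert.prems by auto
    show "\<Union> (insert (Z \<inter> C) \<V>) = Z" using V by auto
    show "\<forall>V\<in>insert (Z \<inter> C) \<V>. \<exists>U\<in>insert U \<U>. V \<subseteq> U"
      using V C by (fastforce simp: disjnt_def)
    show "disjoint (insert (Z \<inter> C) \<V>)"
      using V(3,5) by (auto simp: pairwise_insert disjnt_def)
  qed (use V in auto)
qed

lemma covering_dim_le_0_iff: "covering_dim_le X 0 \<longleftrightarrow> clopen_separated X"
proof
  assume X: "clopen_separated X"
  show "covering_dim_le X 0"
    unfolding covering_dim_le_def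
  proof (intro conjI allI impI, goal_cases)
    case (2 \<U>)
    then obtain \<V> where V: "finite \<V>" "\<forall>V\<in>\<V>. openin X V" "\<Union>\<V> = topspace X"
      "\<forall>V\<in>\<V>. \<exists>U\<in>\<U>. V \<subseteq> U" "disjoint \<V>"
      using clopen_separated_refine[OF X, of \<U> "topspace X"] by auto
    have "int (card {V\<in>\<V>. x \<in> V}) \<le> 0 + 1" for x
    proof -
      have "\<And>a b. a \<in> {V\<in>\<V>. x \<in> V} \<Longrightarrow> b \<in> {V\<in>\<V>. x \<in> V} \<Longrightarrow> a = b"
        using V(5) by (auto simp: pairwise_def disjnt_def)
      then have "card {V\<in>\<V>. x \<in> V} \<le> 1"
        using V(1) by (metis (no_types, lifting) One_nat_def card_le_Suc0_iff_eq finite_subset mem_Collect_eq subsetI)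
      then show ?thesis by simp
    qed
    then show ?case using V by blast
  qed simp
qed (rule covering_dim_le_0_imp_clopen_separated)

text \<open>Open neighbourhoods of \<open>A\<close> and \<open>B\<close> are enlarged step by step;
  step \<open>k\<close> makes them cover \<open>F k\<close>. Keeping their closures disjoint, and
  not just the sets, leaves two disjoint closed sets that normality can enlarge again. In the union
  they are disjoint and exhaust the space, hence clopen.\<close>

lemma clopen_separated_countable_closed_union:
  assumes X: "normal_space X" and F: "\<And>k::nat. closedin X (F k)" "(\<Union>k. F k) = topspace X"
    and sep: "\<And>k. clopen_separated (subtopology X (F k))"
  shows "clopen_separated X"
  unfolding clopen_separated_def
proof (intro allI impI, elim conjE)
  fix A B assume A: "closedin X A" and B: "closedin X B" and AB: "disjnt A B"
  define P where "P = (\<lambda>(U, V). openin X U \<and> openin X V \<and> disjnt (X closure_of U) (X closure_of V))"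
  have enlarge: "\<exists>W. P W \<and> S \<subseteq> fst W \<and> T \<subseteq> snd W"
    if S: "closedin X S" and T: "closedin X T" and d: "disjnt S T" for S T
  proof -
    have "openin X (topspace X - T)" "S \<subseteq> topspace X - T"
      using S T d by (auto simp: disjnt_def dest: closedin_subset)
    with S obtain U where U: "openin X U" "S \<subseteq> U" "X closure_of U \<subseteq> topspace X - T"
      using X unfolding normal_space_alt by metis
    have "openin X (topspace X - X closure_of U)" "T \<subseteq> topspace X - X closure_of U"
      using U T by (auto dest: closedin_subset)
    with T obtain V where "openin X V" "T \<subseteq> V" "X closure_of V \<subseteq> topspace X - X closure_of U"
      using X unfolding normal_space_alt by metis
    with U show ?thesis
      by (intro exI[of _ "(U, V)"]) (auto simp: P_def disjnt_def)
  qed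
  obtain W0 where W0: "P W0" "A \<subseteq> fst W0" "B \<subseteq> snd W0"
    using enlarge[OF A B AB] by blast
  have step: "\<exists>W'. P W' \<and> fst W \<subseteq> fst W' \<and> snd W \<subseteq> snd W' \<and> F k \<subseteq> fst W' \<union> snd W'"
    if "P W" for W k
  proof -
    obtain U V where W: "W = (U, V)" by (cases W)
    have UV: "openin X U" "openin X V" "disjnt (X closure_of U) (X closure_of V)"
      using that by (auto simp: W P_def)
    have "closedin (subtopology X (F k)) (F k \<inter> X closure_of U)"
       "closedin (subtopology X (F k)) (F k \<inter> X closure_of V)"
      by (auto simp: closedin_subtopology_Int_closed)
    moreover have "disjnt (F k \<inter> X closure_of U) (F k \<inter> X closure_of V)"
      using UV by (auto simp: disjnt_def)
    ultimately obtain C where C: "openin (subtopology X (F k)) C" "closedin (subtopology X (F k)) C"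
      "F k \<inter> X closure_of U \<subseteq> C" "disjnt (F k \<inter> X closure_of V) C"
      using clopen_separatedD[OF sep] by metis
    have C1: "closedin X C" "C \<subseteq> F k"
      using C(2) F(1) closedin_closed_subtopology by blast+
    have "closedin (subtopology X (F k)) (topspace (subtopology X (F k)) - C)"
      using C(1) by blast
    moreover have "topspace (subtopology X (F k)) = F k"
      using F(1) closedin_subset by (auto simp: topspace_subtopology)
    ultimately have D1: "closedin X (F k - C)"
      using F(1) closedin_closed_subtopology by metis
    \<comment> \<open>A relatively clopen \<open>C\<close> splits \<open>F k\<close> compatibly with
      both closures. As \<open>F k\<close> is closed, both halves are closed in \<open>X\<close>, so
      they can be absorbed before enlarging.\<close>
    have "disjnt (X closure_of U \<union> C) (X closure_of V \<union> (F k - C))"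
      using UV(3) C(3,4) C1(2) by (auto simp: disjnt_def)
    then obtain W' where W': "P W'" "X closure_of U \<union> C \<subseteq> fst W'" "X closure_of V \<union> (F k - C) \<subseteq> snd W'"
      using enlarge C1 D1 closedin_Un closedin_closure_of by metis
    have "U \<subseteq> X closure_of U" "V \<subseteq> X closure_of V"
      using UV by (auto intro!: closure_of_subset dest: openin_subset)
    with W' show ?thesis by (intro exI[of _ W']) (auto simp: W)
  qed
  \<comment> \<open>The conjunct for \<open>k = 0\<close> pins the start of the chosen sequence to
    \<open>W0\<close>, so that it contains \<open>A\<close> and \<open>B\<close>.\<close>
  have "\<exists>W. \<forall>k. (P (W k) \<and> (k = 0 \<longrightarrow> W k = W0)) \<and> (fst (W k) \<subseteq> fst (W (Suc k)) \<and>
      snd (W k) \<subseteq> snd (W (Suc k)) \<and> F k \<subseteq> fst (W (Suc k)) \<union> snd (W (Suc k)))"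
  proof (rule dependent_nat_choice)
    show "\<exists>W. P W \<and> (0 = 0 \<longrightarrow> W = W0)" using W0 by blast
    fix V and k :: nat assume "P V \<and> (k = 0 \<longrightarrow> V = W0)"
    then show "\<exists>W. (P W \<and> (Suc k = 0 \<longrightarrow> W = W0)) \<and>
      fst V \<subseteq> fst W \<and> snd V \<subseteq> snd W \<and> F k \<subseteq> fst W \<union> snd W"
      using step[of V k] by auto
  qed
  then obtain W where W: "\<And>k. P (W k)" "W 0 = W0" "\<And>k. fst (W k) \<subseteq> fst (W (Suc k))"
    "\<And>k. snd (W k) \<subseteq> snd (W (Suc k))" "\<And>k. F k \<subseteq> fst (W (Suc k)) \<union> snd (W (Suc k))"
    by blast
  have mono: "fst (W j) \<subseteq> fst (W k)" "snd (W j) \<subseteq> snd (W k)" if "j \<le> k" for j k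
    using that W(3,4) lift_Suc_mono_le[of "\<lambda>k. fst (W k)"] lift_Suc_mono_le[of "\<lambda>k. snd (W k)"] by blast+
  have dis: "disjnt (fst (W k)) (snd (W k))" and op: "openin X (fst (W k))" "openin X (snd (W k))" for k
  proof -
    show op: "openin X (fst (W k))" "openin X (snd (W k))"
      using W(1)[of k] by (auto simp: P_def split: prod.splits)
    show "disjnt (fst (W k)) (snd (W k))"
      using W(1)[of k] closure_of_subset[OF openin_subset[OF op(1)]] closure_of_subset[OF openin_subset[OF op(2)]]
      by (auto simp: P_def disjnt_def split: prod.splits)
  qed
  define C where "C = (\<Union>k. fst (W k))"
  define D where "D = (\<Union>k. snd (W k))"
  have oCD: "openin X C" "openin X D" unfolding C_def D_def using op by auto
  have CD: "C \<inter> D = {}"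
  proof -
    have "fst (W j) \<inter> snd (W k) = {}" for j k
      using dis[of "max j k"] mono(1)[of j "max j k"] mono(2)[of k "max j k"] by (auto simp: disjnt_def)
    then show ?thesis by (auto simp: C_def D_def)
  qed
  have "C \<union> D = topspace X"
  proof
    show "C \<union> D \<subseteq> topspace X" using oCD openin_subset by blast
    have "F k \<subseteq> C \<union> D" for k using W(5)[of k] unfolding C_def D_def by blast
    then show "topspace X \<subseteq> C \<union> D" using F(2) by blast
  qed
  then have "topspace X - C = D" using CD by blast
  then have "closedin X C" using oCD openin_subset by (metis closedin_def)
  moreover have "A \<subseteq> C" "B \<subseteq> D" using W0 W(2) unfolding C_def D_def by blast+
  ultimately show "\<exists>C. openin X C \<and> closedin X C \<and> A \<subseteq> C \<and> disjnt B C"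
    using oCD CD by (auto simp: disjnt_def)
qed

text \<open>By the Sura-Bura theorem a component of a compact set has arbitrarily small clopen
  neighbourhoods. Here components are points, and finitely many such neighbourhoods missing
  \<open>B\<close> cover the compact set \<open>A\<close>.\<close>

lemma compact_totally_disconnected_imp_clopen_separated:
  fixes S :: "'a::euclidean_space set"
  assumes S: "compact S" and td: "\<And>C. C \<subseteq> S \<Longrightarrow> connected C \<Longrightarrow> \<exists>a. C \<subseteq> {a}"
  shows "clopen_separated (top_of_set S)"
  unfolding clopen_separated_def
proof (intro allI impI, elim conjE)
  fix A B assume A: "closedin (top_of_set S) A" and B: "closedin (top_of_set S) B" and AB: "disjnt A B"
  have cA: "compact A" and cB: "closed B"
    using A B S by (meson closedin_compact closedin_closed_trans compact_imp_closed)+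
  have "\<exists>K. openin (top_of_set S) K \<and> compact K \<and> a \<in> K \<and> K \<subseteq> - B" if "a \<in> A" for a
  proof -
    have aS: "a \<in> S" using that A by (auto dest: closedin_imp_subset)
    then have "connected_component_set S a \<in> components S" by (auto simp: components_def)
    moreover have "connected_component_set S a = {a}"
    proof -
      obtain b where "connected_component_set S a \<subseteq> {b}"
        using td[OF connected_component_subset] connected_connected_component by metis
      moreover have "a \<in> connected_component_set S a" using connected_component_refl[OF aS] by simp
      ultimately show ?thesis by blast
    qed
    ultimately have c: "{a} \<in> components S" by simp
    have "locally compact S" using S by (simp add: closed_imp_locally_compact compact_imp_closed)
    moreover have "{a} \<subseteq> - B" using that AB by (auto simp: disjnt_def)
    ultimately obtain K where "openin (top_of_set S) K" "compact K" "{a} \<subseteq> K" "K \<subseteq> - B"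
      using Sura_Bura_clopen_subset[OF _ c] cB by (metis compact_sing open_Compl)
    then show ?thesis by blast
  qed
  then obtain K where K: "\<And>a. a \<in> A \<Longrightarrow> openin (top_of_set S) (K a)" "\<And>a. a \<in> A \<Longrightarrow> compact (K a)"
    "\<And>a. a \<in> A \<Longrightarrow> a \<in> K a" "\<And>a. a \<in> A \<Longrightarrow> K a \<subseteq> - B" by metis
  have "compactin (top_of_set S) A"
    using cA A by (auto simp: compactin_subtopology dest: closedin_imp_subset)
  then obtain \<F> where F: "finite \<F>" "\<F> \<subseteq> K ` A" "A \<subseteq> \<Union>\<F>"
    using K unfolding compactin_def by (smt (verit, best) UnionI image_iff subsetI)
  have "closedin (top_of_set S) T" if "T \<in> \<F>" for T
    using that F K by (metis closed_subset compact_imp_closed imageE openin_imp_subset subsetD)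
  then have "closedin (top_of_set S) (\<Union>\<F>)" using F(1) by (intro closedin_Union)
  moreover have "openin (top_of_set S) (\<Union>\<F>)" using F K by (intro openin_Union) blast
  moreover have "disjnt B (\<Union>\<F>)" using F K by (fastforce simp: disjnt_def)
  ultimately show "\<exists>C. openin (top_of_set S) C \<and> closedin (top_of_set S) C \<and> A \<subseteq> C \<and> disjnt B C"
    using F by blast
qed

section \<open>Disjoint refinements of arbitrary open covers\<close>

context Metric_space begin

text \<open>A disjoint open refinement of the cover is encoded by the locally constant function
  that selects the member of the cover. As in Stone's theorem, the points that lie first
  in \<open>U s\<close> with margin \<open>1/(n+1)\<close> form a uniformly discrete family over the indices.\<close>

lemma clopen_separated_disjoint_refinement:
  assumes sep: "clopen_separated mtopology"
    and U: "\<And>x. x \<in> M \<Longrightarrow> openin mtopology (U x)" "\<And>x. x \<in> M \<Longrightarrow> x \<in> U x"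
  obtains c where "\<And>x. x \<in> M \<Longrightarrow> c x \<in> M" "\<And>x. x \<in> M \<Longrightarrow> x \<in> U (c x)"
    "\<And>s. openin mtopology {x \<in> M. c x = s}"
proof -
  obtain r :: "'a rel" where wo: "well_order_on M r" using well_order_on by blast
  have wo2: "Well_order r" "Field r = M" using wo well_order_on_Field by auto
  have tot: "(s,t) \<in> r \<or> (t,s) \<in> r" if "s \<in> M" "t \<in> M" for s t
    using that wo2 by (metis wo_rel.TOTALS wo_rel.intro)
  have anti: "s = t" if "(s,t) \<in> r" "(t,s) \<in> r" for s t
    using that wo unfolding well_order_on_def linear_order_on_def partial_order_on_def antisym_def by blast
  have "\<exists>s\<in>M. x \<in> U s \<and> (\<forall>t\<in>M. x \<in> U t \<longrightarrow> (s,t) \<in> r)" if "x \<in> M" for x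
  proof -
    have "{s\<in>M. x \<in> U s} \<noteq> {}" using U(2) that by blast
    then show ?thesis
      using wo_rel.minim_in[of r "{s\<in>M. x \<in> U s}"] wo_rel.minim_least[of r "{s\<in>M. x \<in> U s}"] wo2
      by (auto simp: wo_rel_def)
  qed
  then obtain s where s: "\<And>x. x \<in> M \<Longrightarrow> s x \<in> M" "\<And>x. x \<in> M \<Longrightarrow> x \<in> U (s x)"
    "\<And>x t. x \<in> M \<Longrightarrow> t \<in> M \<Longrightarrow> x \<in> U t \<Longrightarrow> (s x, t) \<in> r" by metis
  define F where "F n = {x \<in> M. mball x (inverse (Suc n)) \<subseteq> U (s x)}" for n :: nat
  have far: "inverse (Suc n) \<le> d x y" if "x \<in> F n" "y \<in> F n" "s x \<noteq> s y" for x y n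
  proof (rule ccontr)
    assume "\<not> inverse (Suc n) \<le> d x y"
    with that have "y \<in> U (s x)" "x \<in> U (s y)"
      by (auto simp: F_def commute subset_iff)
    then have "(s x, s y) \<in> r" "(s y, s x) \<in> r" using s that by (auto simp: F_def)
    then show False using anti that by blast
  qed
  \<comment> \<open>The radius is a third of the gap in \<open>far\<close>, so one point cannot be
    within it of two points of \<open>F n\<close> with different indices: they would be less than
    two thirds of the gap apart.\<close>
  define O' where "O' n = (\<Union>x\<in>F n. mball x (inverse (Suc n) / 3))" for n
  have OO: "openin mtopology (O' n)" for n by (auto simp: O'_def)
  have "\<exists>C. openin mtopology C \<and> closedin mtopology C \<and> F n \<subseteq> C \<and> C \<subseteq> O' n" for n
  proof -
    have "mtopology closure_of F n \<subseteq> O' n"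
    proof
      fix x assume "x \<in> mtopology closure_of F n"
      moreover have "inverse (Suc n) / 3 > (0::real)" by simp
      ultimately have "x \<in> M" "\<exists>y\<in>F n. y \<in> mball x (inverse (Suc n) / 3)"
        unfolding metric_closure_of by blast+
      then show "x \<in> O' n" unfolding O'_def by (auto simp: commute)
    qed
    then have "disjnt (mtopology closure_of F n) (M - O' n)" by (auto simp: disjnt_def)
    moreover have "closedin mtopology (M - O' n)" using OO by (metis closedin_def double_diff topspace_mtopology openin_subset Diff_subset subset_refl)
    ultimately obtain C where "openin mtopology C" "closedin mtopology C"
      "mtopology closure_of F n \<subseteq> C" "disjnt (M - O' n) C"
      using clopen_separatedD[OF sep closedin_closure_of] by metis
    moreover have "F n \<subseteq> mtopology closure_of F n" by (rule closure_of_subset) (auto simp: F_def)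
    moreover have "C \<subseteq> M" using \<open>openin mtopology C\<close> openin_subset by fastforce
    ultimately show ?thesis by (intro exI[of _ C]) (auto simp: disjnt_def)
  qed
  then obtain C where C: "\<And>n. openin mtopology (C n)" "\<And>n. closedin mtopology (C n)"
    "\<And>n. F n \<subseteq> C n" "\<And>n. C n \<subseteq> O' n" by metis
  have ex: "\<exists>n. x \<in> C n" if x: "x \<in> M" for x
  proof -
    have "openin mtopology (U (s x))" using U s x by blast
    then obtain e where "e > 0" "mball x e \<subseteq> U (s x)" using s(2) x openin_mtopology by metis
    then obtain n where "inverse (Suc n) < e" using reals_Archimedean by blast
    then have "x \<in> F n" using \<open>mball x e \<subseteq> U (s x)\<close> x by (auto simp: F_def subset_iff)
    then show ?thesis using C by blast
  qed
  define N where "N x = (LEAST n. x \<in> C n)" for x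
  have N: "x \<in> C (N x)" if "x \<in> M" for x
    unfolding N_def using LeastI_ex[OF ex[OF that]] .
  have "\<exists>y. y \<in> F (N x) \<and> x \<in> mball y (inverse (Suc (N x)) / 3)" if "x \<in> M" for x
    using N[OF that] C(4) unfolding O'_def by blast
  then obtain b where b: "\<And>x. x \<in> M \<Longrightarrow> b x \<in> F (N x)"
    "\<And>x. x \<in> M \<Longrightarrow> x \<in> mball (b x) (inverse (Suc (N x)) / 3)" by metis
  have bM: "b x \<in> M" if "x \<in> M" for x using b(1)[OF that] by (simp add: F_def)
  \<comment> \<open>Removing the earlier clopen sets freezes the stage \<open>N\<close>, and the
    ball keeps the base points \<open>b\<close> of all points of \<open>W x\<close> closer than the
    gap of that stage. Hence \<open>s \<circ> b\<close> is constant on \<open>W x\<close>.\<close>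
  define W where "W x = (C (N x) - (\<Union>j<N x. C j)) \<inter> mball (b x) (inverse (Suc (N x)) / 3)" for x
  have W: "openin mtopology (W x)" "x \<in> W x" if "x \<in> M" for x
  proof -
    show "openin mtopology (W x)" unfolding W_def using C
      by (intro openin_Int openin_diff closedin_Union) auto
    have "x \<notin> C j" if "j < N x" for j using that not_less_Least unfolding N_def by blast
    then show "x \<in> W x" using b(2) N that unfolding W_def by blast
  qed
  have const: "s (b y) = s (b x)" if "x \<in> M" "y \<in> W x" for x y
  proof (rule ccontr)
    assume ne: "s (b y) \<noteq> s (b x)"
    have y: "y \<in> M" using that by (auto simp: W_def)
    have "N y = N x"
      unfolding N_def[of y] using that by (intro Least_equality) (auto simp: W_def not_less[symmetric])
    then have "inverse (Suc (N x)) \<le> d (b x) (b y)"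
      using far[of "b x" "N x" "b y"] ne b(1) that y by metis
    moreover have "d (b x) (b y) \<le> d (b x) y + d (b y) y" using triangle'[of "b x" y "b y"] bM that y by (simp add: commute triangle)
    moreover have "d (b x) y < inverse (Suc (N x)) / 3" using that by (simp add: W_def)
    moreover have "d (b y) y < inverse (Suc (N x)) / 3" using b(2)[OF y] \<open>N y = N x\<close> by simp
    moreover have "inverse (real (Suc (N x))) > 0" by simp
    ultimately show False by linarith
  qed
  show ?thesis
  proof
    fix x assume x: "x \<in> M"
    show "s (b x) \<in> M" using s bM x by blast
    have "x \<in> mball (b x) (inverse (Suc (N x)))"
    proof -
      have "inverse (real (Suc (N x))) > 0" by simp
      then have "inverse (Suc (N x)) / 3 \<le> inverse (real (Suc (N x)))" by linarith
      from mball_subset_concentric[OF this] show ?thesis using b(2)[OF x] by blast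
    qed
    then show "x \<in> U (s (b x))" using b(1)[OF x] unfolding F_def by blast
  next
    fix t
    have "{x \<in> M. s (b x) = t} = \<Union>(W ` {x \<in> M. s (b x) = t})"
    proof (intro subset_antisym subsetI)
      fix x assume "x \<in> \<Union>(W ` {x \<in> M. s (b x) = t})"
      then obtain y where y: "y \<in> M" "s (b y) = t" "x \<in> W y" by blast
      then have "x \<in> M" using W(1) openin_subset by fastforce
      with y show "x \<in> {x \<in> M. s (b x) = t}" using const by auto
    qed (use W in blast)
    then show "openin mtopology {x \<in> M. s (b x) = t}"
      using W(1) openin_Union[of "W ` {x \<in> M. s (b x) = t}" mtopology] by fastforce
  qed
qed

end

subsection \<open>Lines through a point and their directions\<close>

text \<open>That \<open>g x\<close> lies on the line \<open>z + \<real> u\<close> is stated as an equation in \<open>g x\<close>, \<open>z\<close> and \<open>u\<close>, which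
  passes to limits.\<close>

definition secant_dirs ::
    "('a \<Rightarrow> 'a \<Rightarrow> real) \<Rightarrow> 'a set \<Rightarrow> ('a \<Rightarrow> 'v::euclidean_space) \<Rightarrow> 'v \<Rightarrow> real \<Rightarrow> 'v set" where
  "secant_dirs d K g z e = {u. norm u = 1 \<and> (\<exists>x\<in>K. \<exists>x'\<in>K. e \<le> d x x' \<and>
     e \<le> dist (g x) z \<and> e \<le> dist (g x') z \<and>
     g x - z = ((g x - z) \<bullet> u) *\<^sub>R u \<and> g x' - z = ((g x' - z) \<bullet> u) *\<^sub>R u)}"

lemma mem_line_iff:
  fixes z :: "'v::euclidean_space"
  assumes "norm u = 1"
  shows "x \<in> affine hull {z, z + u} \<longleftrightarrow> x - z = ((x - z) \<bullet> u) *\<^sub>R u"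
proof -
  have "u \<bullet> u = 1" using assms by (simp add: norm_eq_1)
  then have "x - z = ((x - z) \<bullet> u) *\<^sub>R u" if "x = z + r *\<^sub>R u" for r
    using that by simp
  moreover have "x = z + ((x - z) \<bullet> u) *\<^sub>R u" if "x - z = ((x - z) \<bullet> u) *\<^sub>R u"
    using that by (metis add.commute diff_add_cancel)
  ultimately show ?thesis unfolding affine_hull_2_alt by (metis (no_types, lifting) add_diff_cancel_left' rangeE rangeI)
qed

lemma lines_through_point:
  assumes "L \<in> lines" "z \<in> L"
  obtains u where "norm u = 1" "L = affine hull {z, z + u}"
proof -
  have L: "affine L" "aff_dim L = 1" using assms by (auto simp: lines_def)
  have "L \<noteq> {z}" using L by auto
  then obtain w where w: "w \<in> L" "w \<noteq> z" using assms by blast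
  define t where "t = inverse (norm (w - z))"
  define u where "u = t *\<^sub>R (w - z)"
  have u: "norm u = 1" using w by (simp add: u_def t_def)
  have "z + u = (1 - t) *\<^sub>R z + t *\<^sub>R w" by (simp add: u_def algebra_simps)
  then have "z + u \<in> L" using L(1) assms(2) w(1) by (auto simp: affine_alt)
  then have "affine hull {z, z + u} \<subseteq> L" using L(1) assms(2) by (intro hull_minimal) auto
  moreover have "aff_dim (affine hull {z, z + u}) = 1" using u by (auto simp: aff_dim_2)
  ultimately have "affine hull {z, z + u} = L"
    using L by (intro affine_dim_equal) auto
  with u that show ?thesis by blast
qed

lemma line_direction_unique:
  fixes z :: "'v::euclidean_space"
  assumes "norm u = 1" "norm v = 1" "affine hull {z, z + u} = affine hull {z, z + v}"
  shows "u = v \<or> u = - v"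
proof -
  have "z + v \<in> affine hull {z, z + v}" by (simp add: hull_inc)
  then have *: "v = (v \<bullet> u) *\<^sub>R u" using assms mem_line_iff[OF assms(1), of "z + v" z] by simp
  then have "\<bar>v \<bullet> u\<bar> = 1" using assms by (metis mult.right_neutral norm_scaleR)
  then show ?thesis using * by (metis abs_1 abs_eq_iff minus_minus scaleR_minus1_left scaleR_one)
qed

lemma continuous_map_line_through:
  "continuous_map (top_of_set {u. norm u = 1}) line_topology (\<lambda>u::'v::euclidean_space. affine hull {z, z + u})"
  unfolding continuous_map_def
proof (intro conjI allI impI)
  show "(\<lambda>u. affine hull {z, z + u}) \<in> topspace (top_of_set {u. norm u = 1}) \<rightarrow> topspace line_topology"
    by (auto intro!: line_through_in_lines)
  fix \<L> :: "'v set set" assume "openin line_topology \<L>"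
  then have o: "open {(a, b). a \<noteq> b \<and> affine hull {a, b} \<in> \<L>}" by (simp add: openin_line_topology)
  have "open ((\<lambda>u. (z, z + u)) -` {(a, b). a \<noteq> b \<and> affine hull {a, b} \<in> \<L>})"
    by (intro open_vimage[OF o] continuous_intros)
  moreover have "{x \<in> topspace (top_of_set {u. norm u = 1}). affine hull {z, z + x} \<in> \<L>} =
     {u. norm u = 1} \<inter> ((\<lambda>u. (z, z + u)) -` {(a, b). a \<noteq> b \<and> affine hull {a, b} \<in> \<L>})"
    by auto
  ultimately show "openin (top_of_set {u. norm u = 1})
     {x \<in> topspace (top_of_set {u. norm u = 1}). affine hull {z, z + x} \<in> \<L>}"
    by (simp only: openin_open_Int)
qed

text \<open>Two distinct points span a line other than \<open>L\<close> iff they do not both lie on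
  the closed set \<open>L\<close>, an open condition on pairs. This allows two distinct lines to be
  separated by a clopen set.\<close>

lemma closedin_line_topology_singleton:
  assumes "L \<in> lines"
  shows "closedin line_topology {L}"
proof -
  have L: "affine L" "aff_dim L = 1" "closed L" using assms by (auto simp: lines_def affine_closed)
  have eq: "a \<noteq> b \<Longrightarrow> affine hull {a, b} = L \<longleftrightarrow> a \<in> L \<and> b \<in> L" for a b
  proof
    assume ab: "a \<noteq> b" "a \<in> L \<and> b \<in> L"
    then have "affine hull {a, b} \<subseteq> L" using L by (intro hull_minimal) auto
    then show "affine hull {a, b} = L" using L ab by (intro affine_dim_equal) (auto simp: aff_dim_2)
  qed (auto intro: hull_inc)
  have "(a \<noteq> b \<and> affine hull {a, b} \<in> lines - {L}) \<longleftrightarrow> (a \<noteq> b \<and> \<not> (a \<in> L \<and> b \<in> L))" for a b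
    using eq[of a b] line_through_in_lines[of a b] by blast
  then have "{(a, b). a \<noteq> b \<and> affine hull {a, b} \<in> lines - {L}} = {p. fst p \<noteq> snd p} \<inter> (- (L \<times> L))"
    by auto
  moreover have "open ({p. fst p \<noteq> snd p} \<inter> (- (L \<times> L)))"
    using L by (intro open_Int open_Collect_neq continuous_intros open_Compl closed_Times)
  ultimately show ?thesis using assms
    by (auto simp: closedin_def openin_line_topology)
qed

text \<open>The lines with directions in \<open>C\<close> form a connected set in a zero-dimensional
  space with closed points, so they are all one line. A line has only two unit directions, and a
  finite connected set has at most one point.\<close>

lemma connected_directions_of_clopen_separated_lines:
  fixes z :: "'v::euclidean_space"
  assumes P: "clopen_separated (subtopology line_topology P)" "P \<subseteq> lines"
    and C: "connected C" "C \<subseteq> {u. norm u = 1 \<and> affine hull {z, z + u} \<in> P}"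
  shows "\<exists>a. C \<subseteq> {a}"
proof -
  let ?q = "\<lambda>u. affine hull {z, z + u}"
  have "connectedin (top_of_set {u. norm u = 1}) C"
    using C by (auto simp: connectedin_subtopology)
  then have "connectedin line_topology (?q ` C)"
    using connectedin_continuous_map_image[OF continuous_map_line_through] by blast
  then have con: "connectedin (subtopology line_topology P) (?q ` C)"
    using C by (auto simp: connectedin_subtopology)
  have same: "?q u = ?q v" if "u \<in> C" "v \<in> C" for u v
  proof (rule ccontr)
    assume ne: "?q u \<noteq> ?q v"
    have uv: "?q u \<in> P" "?q v \<in> P" using that C by auto
    have "closedin (subtopology line_topology P) {?q u}" "closedin (subtopology line_topology P) {?q v}"
      using uv P(2) closedin_line_topology_singleton by (auto simp: closedin_subset_topspace closedin_subtopology)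
    moreover have "disjnt {?q u} {?q v}" using ne by simp
    ultimately obtain E where "openin (subtopology line_topology P) E" "closedin (subtopology line_topology P) E"
       "{?q u} \<subseteq> E" "disjnt {?q v} E"
      by (rule clopen_separatedD[OF P(1)])
    then show False using connectedin_clopen_cases[OF con, of E] that by (auto simp: disjnt_def)
  qed
  have "finite C"
  proof (cases "C = {}")
    case False
    then obtain u where u: "u \<in> C" by blast
    have "C \<subseteq> {u, - u}"
      using line_direction_unique same[OF u] u C(2) by fastforce
    then show ?thesis by (rule finite_subset) simp
  qed simp
  then have "C = {} \<or> (\<exists>a. C = {a})" using C(1) connected_finite_iff_sing by blast
  then show ?thesis by auto
qed

text \<open>Passing from directions to lines identifies \<open>u\<close> with \<open>-u\<close>, so
  symmetric sets are the saturated ones. Openness of lines is tested on all pairs of distinct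
  points, not only on those through \<open>z\<close>; therefore the open set is extended to the
  lines anywhere in space whose directions \<open>sgn (b - a)\<close> lie in the symmetric open set
  \<open>Q\<close>.\<close>

lemma openin_lines_of_symmetric_directions:
  fixes z :: "'v::euclidean_space"
  assumes P: "P \<subseteq> lines" "\<And>L. L \<in> P \<Longrightarrow> z \<in> L" and D: "D = {u. norm u = 1 \<and> affine hull {z, z + u} \<in> P}"
    and W: "openin (top_of_set D) W" "\<And>u. u \<in> W \<Longrightarrow> - u \<in> W"
  shows "openin (subtopology line_topology P) ((\<lambda>u. affine hull {z, z + u}) ` W)"
proof -
  obtain V where V: "open V" "W = D \<inter> V" using W(1) openin_open by metis
  define Q where "Q = V \<inter> uminus -` V"
  have oQ: "open Q" unfolding Q_def using V by (intro open_Int open_vimage continuous_intros)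
  have sym: "- u \<in> Q" if "u \<in> Q" for u using that by (auto simp: Q_def)
  define T :: "'v set set" where "T = {L \<in> lines. \<forall>a\<in>L. \<forall>b\<in>L. a \<noteq> b \<longrightarrow> sgn (b - a) \<in> Q}"
  have line: "affine hull {a, b} \<in> T \<longleftrightarrow> sgn (b - a) \<in> Q" if "a \<noteq> b" for a b
  proof
    assume s: "sgn (b - a) \<in> Q"
    have "sgn (b' - a') \<in> Q" if ab: "a' \<in> affine hull {a, b}" "b' \<in> affine hull {a, b}" "a' \<noteq> b'" for a' b'
    proof -
      obtain r r' where rr: "a' = a + r *\<^sub>R (b - a)" "b' = a + r' *\<^sub>R (b - a)"
        using ab(1,2) unfolding affine_hull_2_alt by blast
      have e: "b' - a' = (r' - r) *\<^sub>R (b - a)" by (simp add: rr scaleR_left_diff_distrib)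
      then have "r' - r \<noteq> 0" using ab(3) by auto
      then have "sgn (r' - r) = 1 \<or> sgn (r' - r) = -1" by (auto simp: sgn_if)
      moreover have "sgn (b' - a') = sgn (r' - r) *\<^sub>R sgn (b - a)" unfolding e by (rule sgn_scaleR)
      ultimately show ?thesis using s sym by (metis scaleR_minus1_left scaleR_one)
    qed
    then show "affine hull {a, b} \<in> T" using that by (auto simp: T_def line_through_in_lines)
  qed (use that in \<open>auto simp: T_def hull_inc\<close>)
  have "openin line_topology T"
    unfolding openin_line_topology
  proof
    have "{(a, b). a \<noteq> b \<and> affine hull {a, b} \<in> T} =
        {p. fst p \<noteq> snd p} \<inter> (\<lambda>p. sgn (snd p - fst p)) -` Q"
      using line by auto
    moreover have op: "open {p::'v\<times>'v. fst p \<noteq> snd p}"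
      by (intro open_Collect_neq continuous_intros)
    moreover have "continuous_on {p::'v\<times>'v. fst p \<noteq> snd p} (\<lambda>p. sgn (snd p - fst p))"
      by (intro continuous_intros) auto
    ultimately show "open {(a, b). a \<noteq> b \<and> affine hull {a, b} \<in> T}"
      using oQ by (simp add: continuous_on_open_vimage[OF op] Int_commute)
  qed (auto simp: T_def)
  moreover have "(\<lambda>u. affine hull {z, z + u}) ` W = T \<inter> P"
  proof (intro subset_antisym subsetI)
    fix L assume "L \<in> (\<lambda>u. affine hull {z, z + u}) ` W"
    then obtain u where u: "u \<in> W" "L = affine hull {z, z + u}" by blast
    then have "u \<in> D" "u \<in> Q" using V W(2) by (auto simp: Q_def)
    then have nu: "norm u = 1" "L \<in> P" using u D by auto
    then have "z \<noteq> z + u" by auto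
    moreover have "sgn (z + u - z) = u" using nu by (simp add: sgn_div_norm)
    ultimately have "L \<in> T" using line \<open>u \<in> Q\<close> u by metis
    then show "L \<in> T \<inter> P" using nu by blast
  next
    fix L assume L: "L \<in> T \<inter> P"
    then obtain u where u: "norm u = 1" "L = affine hull {z, z + u}"
      using lines_through_point P by (metis IntD2 subsetD)
    moreover have "z \<noteq> z + u" "sgn (z + u - z) = u" using u by (auto simp: sgn_div_norm)
    ultimately have "u \<in> Q" using line L by (metis IntD1)
    then have "u \<in> W" using u L D V by (auto simp: Q_def)
    then show "L \<in> (\<lambda>u. affine hull {z, z + u}) ` W" using u by blast
  qed
  ultimately show ?thesis by (auto simp: openin_subtopology)
qed

text \<open>A clopen set \<open>C\<close> separating the preimages of \<open>A\<close> and
  \<open>B\<close> need not be symmetric, but \<open>C \<inter> - C\<close> is. It still contains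
  the preimage of \<open>A\<close>, which is symmetric itself, and its complement is symmetric too,
  so both have open images.\<close>

lemma clopen_separated_lines_of_directions:
  fixes z :: "'v::euclidean_space"
  assumes P: "P \<subseteq> lines" "\<And>L. L \<in> P \<Longrightarrow> z \<in> L"
    and sep: "clopen_separated (top_of_set {u. norm u = 1 \<and> affine hull {z, z + u} \<in> P})"
  shows "clopen_separated (subtopology line_topology P)"
  unfolding clopen_separated_def
proof (intro allI impI, elim conjE)
  let ?q = "\<lambda>u. affine hull {z, z + u}" and ?X = "subtopology line_topology P"
  define D where "D = {u. norm u = 1 \<and> ?q u \<in> P}"
  have tX: "topspace ?X = P" using P(1) by (auto simp: topspace_subtopology)
  have qm: "?q (- u) = ?q u" if "norm u = 1" for u
  proof -
    have "x \<in> ?q (- u) \<longleftrightarrow> x \<in> ?q u" for x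
      using mem_line_iff[of u x z] mem_line_iff[of "-u" x z] that by simp
    then show ?thesis by blast
  qed
  have Dm: "- u \<in> D" if "u \<in> D" for u using that qm by (auto simp: D_def)
  have homD: "openin (top_of_set D) (uminus ` W)" if W: "openin (top_of_set D) W" for W
  proof -
    obtain V where V: "open V" "W = D \<inter> V" using W openin_open by metis
    have "uminus ` W = D \<inter> uminus ` V" using V(2) Dm by force
    then show ?thesis using V(1) open_negations by (metis openin_open_Int)
  qed
  fix A B assume A: "closedin ?X A" and B: "closedin ?X B" and AB: "disjnt A B"
  have cont: "continuous_map (top_of_set D) ?X ?q"
  proof -
    have "continuous_map (subtopology (top_of_set {u. norm u = 1}) D) line_topology ?q"
      using continuous_map_line_through by (rule continuous_map_from_subtopology)
    moreover have "subtopology (top_of_set {u::'v. norm u = 1}) D = top_of_set D"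
      by (simp add: subtopology_subtopology Int_absorb1 D_def Collect_mono)
    ultimately show ?thesis by (auto simp: continuous_map_in_subtopology D_def)
  qed
  have "closedin (top_of_set D) {u \<in> D. ?q u \<in> A}" "closedin (top_of_set D) {u \<in> D. ?q u \<in> B}"
    using closedin_continuous_map_preimage[OF cont A] closedin_continuous_map_preimage[OF cont B] by auto
  moreover have "disjnt {u \<in> D. ?q u \<in> A} {u \<in> D. ?q u \<in> B}" using AB by (auto simp: disjnt_def)
  ultimately obtain C where C: "openin (top_of_set D) C" "closedin (top_of_set D) C"
    "{u \<in> D. ?q u \<in> A} \<subseteq> C" "disjnt {u \<in> D. ?q u \<in> B} C"
    by (rule clopen_separatedD[OF sep[folded D_def]])
  define S where "S = C \<inter> uminus ` C"
  have CD: "C \<subseteq> D" using C(1) openin_imp_subset by blast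
  have oC: "openin (top_of_set D) (D - C)" using C(2) by (simp add: closedin_def)
  have S1: "openin (top_of_set D) S" unfolding S_def using C(1) homD by blast
  have S2: "D - S = (D - C) \<union> uminus ` (D - C)"
    unfolding S_def using Dm CD by (force simp: image_iff)
  then have S3: "openin (top_of_set D) (D - S)" using oC homD by auto
  have symS: "- u \<in> S" if "u \<in> S" for u using that by (auto simp: S_def)
  have symDS: "- u \<in> D - S" if "u \<in> D - S" for u using that Dm symS by fastforce
  have o1: "openin ?X (?q ` S)"
    by (rule openin_lines_of_symmetric_directions[OF P D_def S1 symS])
  have o2: "openin ?X (?q ` (D - S))"
    by (rule openin_lines_of_symmetric_directions[OF P D_def S3 symDS])
  have SD: "S \<subseteq> D" using CD by (auto simp: S_def)
  have PD: "\<exists>u\<in>D. L = ?q u" if "L \<in> P" for L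
    using lines_through_point[of L z] P that unfolding D_def by (metis (mono_tags, lifting) mem_Collect_eq subsetD)
  have dis: "?q u \<noteq> ?q v" if "u \<in> S" "v \<in> D - S" for u v
  proof
    assume "?q u = ?q v"
    then have "u = v \<or> u = - v"
      using line_direction_unique[of u v z] that SD unfolding D_def by blast
    then have "v = u \<or> v = - u" by auto
    then show False using that symS by blast
  qed
  have "P - ?q ` S = ?q ` (D - S)"
    using PD dis by (fastforce simp: D_def)
  then have "closedin ?X (?q ` S)"
    using o1 o2 tX by (metis closedin_def openin_subset)
  moreover have "A \<subseteq> ?q ` S"
  proof
    fix L assume L: "L \<in> A"
    then have "L \<in> P" using A tX closedin_subset by blast
    then obtain u where u: "u \<in> D" "L = ?q u" using PD by blast
    then have "u \<in> C" "- u \<in> C" using C(3) L Dm qm by (auto simp: D_def)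
    then have "u \<in> S" by (force simp: S_def)
    then show "L \<in> ?q ` S" using u by blast
  qed
  moreover have "disjnt B (?q ` S)"
    using C(4) SD by (auto simp: S_def disjnt_def)
  ultimately show "\<exists>C. openin ?X C \<and> closedin ?X C \<and> A \<subseteq> C \<and> disjnt B C" using o1 by blast
qed

text \<open>A secant is witnessed by a single pair of points. Their distance is positive, and so are
  the distances of their values from \<open>z\<close> because \<open>z\<close> is off the image; any
  scale below these three numbers works. Conversely a positive scale forces the two points to
  differ.\<close>

lemma secant_direction_iff:
  assumes "Metric_space M d" "K \<subseteq> M" and z: "z \<notin> g ` K"
  shows "norm u = 1 \<and> affine hull {z, z + u} \<in> secant_lines K g z \<longleftrightarrow>
    (\<exists>n. u \<in> secant_dirs d K g z (inverse (Suc n)))"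
proof (cases "norm u = 1")
  case u: True
  interpret Metric_space M d by fact
  have "z \<noteq> z + u" using u by auto
  then have lin: "affine hull {z, z + u} \<in> lines" "z \<in> affine hull {z, z + u}"
    by (auto simp: line_through_in_lines hull_inc)
  have two: "infinite S \<or> 2 \<le> card S \<longleftrightarrow> (\<exists>x\<in>S. \<exists>y\<in>S. x \<noteq> y)" for S :: "'a set"
    by (cases "finite S") (auto simp: numeral_2_eq_2 not_less_eq_eq[symmetric] card_le_Suc0_iff_eq
        dest: infinite_imp_nonempty, metis finite.emptyI finite.insertI insertI1 finite_subset subsetI)
  have "affine hull {z, z + u} \<in> secant_lines K g z \<longleftrightarrow>
    (\<exists>x\<in>K. \<exists>x'\<in>K. x \<noteq> x' \<and> g x - z = ((g x - z) \<bullet> u) *\<^sub>R u \<and> g x' - z = ((g x' - z) \<bullet> u) *\<^sub>R u)"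
    unfolding secant_lines_def mem_Collect_eq two using lin by (auto simp: mem_line_iff[OF u])
  also have "\<dots> \<longleftrightarrow> (\<exists>n. u \<in> secant_dirs d K g z (inverse (Suc n)))"
  proof
    assume "\<exists>x\<in>K. \<exists>x'\<in>K. x \<noteq> x' \<and> g x - z = ((g x - z) \<bullet> u) *\<^sub>R u \<and> g x' - z = ((g x' - z) \<bullet> u) *\<^sub>R u"
    then obtain x x' where x: "x \<in> K" "x' \<in> K" "x \<noteq> x'" "g x - z = ((g x - z) \<bullet> u) *\<^sub>R u"
      "g x' - z = ((g x' - z) \<bullet> u) *\<^sub>R u" by blast
    have "0 < min (d x x') (min (dist (g x) z) (dist (g x') z))"
      using x z assms(2) mdist_pos_eq[of x x'] by (auto simp: subset_iff)
    then obtain n where "inverse (Suc n) < min (d x x') (min (dist (g x) z) (dist (g x') z))"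
      using reals_Archimedean by blast
    then show "\<exists>n. u \<in> secant_dirs d K g z (inverse (Suc n))"
      using x u unfolding secant_dirs_def by (intro exI[of _ n]) force
  next
    assume "\<exists>n. u \<in> secant_dirs d K g z (inverse (Suc n))"
    then obtain n x x' where x: "x \<in> K" "x' \<in> K" "inverse (Suc n) \<le> d x x'" "g x - z = ((g x - z) \<bullet> u) *\<^sub>R u"
      "g x' - z = ((g x' - z) \<bullet> u) *\<^sub>R u" unfolding secant_dirs_def by blast
    have "x \<noteq> x'"
    proof
      assume "x = x'"
      then have "d x x' = 0" using x assms(2) by auto
      moreover have "inverse (real (Suc n)) > 0" by simp
      ultimately show False using x(3) by linarith
    qed
    then show "\<exists>x\<in>K. \<exists>x'\<in>K. x \<noteq> x' \<and> g x - z = ((g x - z) \<bullet> u) *\<^sub>R u \<and> g x' - z = ((g x' - z) \<bullet> u) *\<^sub>R u"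
      using x by blast
  qed
  finally show ?thesis using u by blast
qed (auto simp: secant_dirs_def)

subsection \<open>Limits along the fibres of a perfect map\<close>

text \<open>Asking for a definite distance, and not merely for two distinct points, keeps the
  connected sets from shrinking to a point in a limit.\<close>

definition wide :: "'v::metric_space set \<Rightarrow> real \<Rightarrow> bool" where
  "wide S e \<longleftrightarrow> (\<exists>C\<subseteq>S. connected C \<and> (\<exists>p\<in>C. \<exists>q\<in>C. e \<le> dist p q))"

locale perfect_metric_map = X: Metric_space MX dX + Y: Metric_space MY dY
  for MX :: "'a set" and dX and MY :: "'b set" and dY +
  fixes f :: "'a \<Rightarrow> 'b"
  assumes cont: "continuous_map X.mtopology Y.mtopology f"
    and perf: "proper_map X.mtopology Y.mtopology f"
begin

definition fib :: "'b \<Rightarrow> 'a set" where "fib y = {x \<in> MX. f x = y}"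

lemma f_in: "x \<in> MX \<Longrightarrow> f x \<in> MY"
  using continuous_map_funspace[OF cont] by (auto simp: Pi_iff)

lemma fib_compact: "compactin X.mtopology (fib y)"
proof (cases "y \<in> MY")
  case True
  then show ?thesis using perf by (auto simp: proper_map_def fib_def)
next
  case False
  then have "fib y = {}" using f_in by (auto simp: fib_def)
  then show ?thesis by simp
qed

lemma fibre_neighbourhood:
  assumes "openin X.mtopology U" "y \<in> MY" "fib y \<subseteq> U"
  obtains r where "r > 0" "\<And>x. x \<in> MX \<Longrightarrow> dY y (f x) < r \<Longrightarrow> x \<in> U"
proof -
  have "closed_map X.mtopology Y.mtopology f" using perf by (simp add: proper_map_def)
  then have "\<exists>V. openin Y.mtopology V \<and> y \<in> V \<and> {x \<in> MX. f x \<in> V} \<subseteq> U"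
    using assms unfolding closed_map_fibre_neighbourhood fib_def by simp
  then obtain V where V: "openin Y.mtopology V" "y \<in> V" "{x \<in> MX. f x \<in> V} \<subseteq> U" by blast
  then obtain r where "r > 0" "Y.mball y r \<subseteq> V" unfolding Y.openin_mtopology by blast
  moreover have "x \<in> U" if "x \<in> MX" "dY y (f x) < r" for x
  proof -
    have "f x \<in> Y.mball y r" using that assms(2) f_in by simp
    then show ?thesis using V(3) \<open>Y.mball y r \<subseteq> V\<close> that(1) by blast
  qed
  ultimately show ?thesis using that by blast
qed

text \<open>The base points together with their limit form a compact set, whose preimage under the
  proper map \<open>f\<close> is compact and contains the whole sequence.\<close>

lemma fibre_subsequence:
  assumes ys: "limitin Y.mtopology ys y sequentially" and xs: "\<And>i::nat. xs i \<in> fib (ys i)"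
  obtains x r where "x \<in> fib y" "strict_mono r" "limitin X.mtopology (xs \<circ> r) x sequentially"
proof -
  have "ys i \<in> MY" for i using xs[of i] f_in[of "xs i"] by (auto simp: fib_def)
  then have ysM: "range ys \<subseteq> MY" by blast
  have "compactin Y.mtopology (insert y (range ys))"
    using ysM by (intro compactin_sequence_with_limit[OF ys]) auto
  then have "compactin X.mtopology {x \<in> topspace X.mtopology. f x \<in> insert y (range ys)}"
    using perf by (rule compactin_proper_map_preimage[rotated])
  moreover have "range xs \<subseteq> {x \<in> topspace X.mtopology. f x \<in> insert y (range ys)}"
    using xs by (auto simp: fib_def)
  ultimately have "\<exists>x r. x \<in> {x \<in> topspace X.mtopology. f x \<in> insert y (range ys)} \<and> strict_mono r \<and>
      limitin X.mtopology (xs \<circ> r) x sequentially"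
    unfolding X.compactin_sequentially by blast
  then obtain x r where x: "x \<in> MX" "strict_mono r" "limitin X.mtopology (xs \<circ> r) x sequentially"
    by auto
  have "limitin Y.mtopology (f \<circ> (xs \<circ> r)) (f x) sequentially"
    using continuous_map_limit[OF cont x(3)] .
  moreover have "f \<circ> (xs \<circ> r) = ys \<circ> r" using xs by (auto simp: fib_def)
  moreover have "limitin Y.mtopology (ys \<circ> r) y sequentially"
    using limitin_subsequence[OF x(2) ys] .
  ultimately have "f x = y" using Y.limitin_metric_unique by (metis sequentially_bot)
  with x that show ?thesis by (simp add: fib_def)
qed

lemma tendsto_along_fibres:
  assumes g: "continuous_map X.mtopology euclidean (g::'a \<Rightarrow> 'v::euclidean_space)"
    and xs: "limitin X.mtopology xs x sequentially"
    and gs: "\<And>i. dist (gs i (xs i)) (g (xs i)) \<le> \<delta> i" and "\<delta> \<longlonglongrightarrow> 0"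
  shows "(\<lambda>i::nat. gs i (xs i)) \<longlonglongrightarrow> g x"
proof -
  have 1: "(\<lambda>i. g (xs i)) \<longlonglongrightarrow> g x"
    using continuous_map_limit[OF g xs] by (simp add: o_def)
  have 2: "(\<lambda>i. gs i (xs i) - g (xs i)) \<longlonglongrightarrow> 0"
  proof (rule Lim_null_comparison)
    show "\<forall>\<^sub>F i in sequentially. norm (gs i (xs i) - g (xs i)) \<le> \<delta> i"
      using gs by (simp add: dist_norm)
  qed fact
  show ?thesis using tendsto_add[OF 1 2] by simp
qed

text \<open>Three successive subsequences make both preimages and the direction converge. The
  defining conditions are equations and weak inequalities, so they pass to the limit.\<close>

lemma secant_dirs_limit:
  assumes g: "continuous_map X.mtopology euclidean (g::'a \<Rightarrow> 'v::euclidean_space)"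
    and ys: "limitin Y.mtopology ys y sequentially"
    and gs: "\<And>i x. x \<in> fib (ys i) \<Longrightarrow> dist (gs i x) (g x) \<le> \<delta> i" and "\<delta> \<longlonglongrightarrow> 0"
    and zs: "zs \<longlonglongrightarrow> z"
    and us: "\<And>i::nat. us i \<in> secant_dirs dX (fib (ys i)) (gs i) (zs i) e"
  obtains u r where "u \<in> secant_dirs dX (fib y) g z e" "strict_mono r" "(us \<circ> r) \<longlonglongrightarrow> u"
proof -
  have "\<forall>i. \<exists>x x'. x \<in> fib (ys i) \<and> x' \<in> fib (ys i) \<and> e \<le> dX x x' \<and>
     e \<le> dist (gs i x) (zs i) \<and> e \<le> dist (gs i x') (zs i) \<and>
     gs i x - zs i = ((gs i x - zs i) \<bullet> us i) *\<^sub>R us i \<and> gs i x' - zs i = ((gs i x' - zs i) \<bullet> us i) *\<^sub>R us i"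
    using us unfolding secant_dirs_def by blast
  then obtain xs xs' where x: "\<And>i. xs i \<in> fib (ys i)" "\<And>i. xs' i \<in> fib (ys i)" "\<And>i. e \<le> dX (xs i) (xs' i)"
     "\<And>i. e \<le> dist (gs i (xs i)) (zs i)" "\<And>i. e \<le> dist (gs i (xs' i)) (zs i)"
     "\<And>i. gs i (xs i) - zs i = ((gs i (xs i) - zs i) \<bullet> us i) *\<^sub>R us i"
     "\<And>i. gs i (xs' i) - zs i = ((gs i (xs' i) - zs i) \<bullet> us i) *\<^sub>R us i" by metis
  obtain a r1 where a: "a \<in> fib y" "strict_mono r1" "limitin X.mtopology (xs \<circ> r1) a sequentially"
    using fibre_subsequence[OF ys x(1)] .
  have "limitin Y.mtopology (ys \<circ> r1) y sequentially" using limitin_subsequence[OF a(2) ys] .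
  then obtain a' r2 where a': "a' \<in> fib y" "strict_mono r2" "limitin X.mtopology ((xs' \<circ> r1) \<circ> r2) a' sequentially"
    using fibre_subsequence[of "ys \<circ> r1" y "xs' \<circ> r1"] x(2) by auto
  have "\<And>i. (us \<circ> r1 \<circ> r2) i \<in> sphere 0 1" using us by (auto simp: secant_dirs_def)
  then obtain u r3 where u: "u \<in> sphere 0 1" "strict_mono r3" "((us \<circ> r1 \<circ> r2) \<circ> r3) \<longlonglongrightarrow> u"
    using compact_sphere[of "0::'v" 1] unfolding compact_def by metis
  define r where "r = r1 \<circ> r2 \<circ> r3"
  have r: "strict_mono r" unfolding r_def using a(2) a'(2) u(2) by (simp add: strict_mono_o)
  have la: "limitin X.mtopology (xs \<circ> r) a sequentially"
    using limitin_subsequence[OF _ a(3), of "r2 \<circ> r3"] a'(2) u(2) by (simp add: r_def o_assoc strict_mono_o)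
  have la': "limitin X.mtopology (xs' \<circ> r) a' sequentially"
    using limitin_subsequence[OF u(2) a'(3)] by (simp add: r_def o_assoc)
  have lu: "(\<lambda>i. us (r i)) \<longlonglongrightarrow> u" using u(3) by (simp add: r_def o_def)
  have lz: "(\<lambda>i. zs (r i)) \<longlonglongrightarrow> z" using LIMSEQ_subseq_LIMSEQ[OF zs r] by (simp add: o_def)
  have d: "(\<lambda>i. \<delta> (r i)) \<longlonglongrightarrow> 0" using LIMSEQ_subseq_LIMSEQ[OF \<open>\<delta> \<longlonglongrightarrow> 0\<close> r] by (simp add: o_def)
  have lg: "(\<lambda>i. gs (r i) (xs (r i))) \<longlonglongrightarrow> g a"
    using tendsto_along_fibres[OF g la, of "\<lambda>i. gs (r i)" "\<lambda>i. \<delta> (r i)"] gs x(1) d by simp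
  have lg': "(\<lambda>i. gs (r i) (xs' (r i))) \<longlonglongrightarrow> g a'"
    using tendsto_along_fibres[OF g la', of "\<lambda>i. gs (r i)" "\<lambda>i. \<delta> (r i)"] gs x(2) d by simp
  have aM: "a \<in> MX" "a' \<in> MX" using a a' by (auto simp: fib_def)
  have xM: "xs i \<in> MX" "xs' i \<in> MX" for i using x(1,2) by (auto simp: fib_def)
  \<comment> \<open>The triangle inequality bounds \<open>e\<close> by a sum that tends to
    \<open>dX a a'\<close>, in place of joint continuity of the metric.\<close>
  have "e \<le> dX a a'"
  proof (rule tendsto_lowerbound)
    have "(\<lambda>i. dX (xs (r i)) a) \<longlonglongrightarrow> 0" "(\<lambda>i. dX (xs' (r i)) a') \<longlonglongrightarrow> 0"
      using la la' by (auto simp: X.limitin_metric_dist_null)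
    then have "(\<lambda>i. dX (xs (r i)) a + dX a a' + dX (xs' (r i)) a') \<longlonglongrightarrow> 0 + dX a a' + 0"
      by (intro tendsto_intros)
    then show "(\<lambda>i. dX (xs (r i)) a + dX a a' + dX (xs' (r i)) a') \<longlonglongrightarrow> dX a a'" by simp
    have "e \<le> dX (xs i) a + dX a a' + dX (xs' i) a'" for i
      using x(3)[of i] X.triangle[of "xs i" a "xs' i"] X.triangle[of a a' "xs' i"] X.commute[of a' "xs' i"] aM xM[of i] by linarith
    then show "\<forall>\<^sub>F i in sequentially. e \<le> dX (xs (r i)) a + dX a a' + dX (xs' (r i)) a'" by simp
  qed simp
  moreover have "e \<le> dist (g a) z"
    by (rule tendsto_lowerbound[OF tendsto_dist[OF lg lz]]) (use x(4) in auto)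
  moreover have "e \<le> dist (g a') z"
    by (rule tendsto_lowerbound[OF tendsto_dist[OF lg' lz]]) (use x(5) in auto)
  moreover have "g a - z = ((g a - z) \<bullet> u) *\<^sub>R u"
  proof (rule LIMSEQ_unique)
    show "(\<lambda>i. gs (r i) (xs (r i)) - zs (r i)) \<longlonglongrightarrow> g a - z" by (intro tendsto_intros lg lz)
    have "(\<lambda>i. ((gs (r i) (xs (r i)) - zs (r i)) \<bullet> us (r i)) *\<^sub>R us (r i)) \<longlonglongrightarrow> ((g a - z) \<bullet> u) *\<^sub>R u"
      by (intro tendsto_intros lg lz lu)
    then show "(\<lambda>i. gs (r i) (xs (r i)) - zs (r i)) \<longlonglongrightarrow> ((g a - z) \<bullet> u) *\<^sub>R u"
      using x(6) by simp
  qed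
  moreover have "g a' - z = ((g a' - z) \<bullet> u) *\<^sub>R u"
  proof (rule LIMSEQ_unique)
    show "(\<lambda>i. gs (r i) (xs' (r i)) - zs (r i)) \<longlonglongrightarrow> g a' - z" by (intro tendsto_intros lg' lz)
    have "(\<lambda>i. ((gs (r i) (xs' (r i)) - zs (r i)) \<bullet> us (r i)) *\<^sub>R us (r i)) \<longlonglongrightarrow> ((g a' - z) \<bullet> u) *\<^sub>R u"
      by (intro tendsto_intros lg' lz lu)
    then show "(\<lambda>i. gs (r i) (xs' (r i)) - zs (r i)) \<longlonglongrightarrow> ((g a' - z) \<bullet> u) *\<^sub>R u"
      using x(7) by simp
  qed
  ultimately have "u \<in> secant_dirs dX (fib y) g z e"
    using a(1) a'(1) u(1) unfolding secant_dirs_def by (auto simp: dist_norm)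
  then show ?thesis using that r lu by (simp add: o_def)
qed

text \<open>Sequential compactness is the limit lemma for a constant fibre, map and point.\<close>

lemma compact_secant_dirs:
  assumes g: "continuous_map X.mtopology euclidean (g::'a \<Rightarrow> 'v::euclidean_space)" and y: "y \<in> MY"
  shows "compact (secant_dirs dX (fib y) g z e)"
  unfolding compact_def
proof (intro allI impI)
  fix us :: "nat \<Rightarrow> 'v" assume "\<forall>i. us i \<in> secant_dirs dX (fib y) g z e"
  then obtain u r where "u \<in> secant_dirs dX (fib y) g z e" "strict_mono r" "(us \<circ> r) \<longlonglongrightarrow> u"
    using secant_dirs_limit[OF g, of "\<lambda>_. y" y "\<lambda>_. g" "\<lambda>_. 0" "\<lambda>_. z" z us e] y by auto
  then show "\<exists>l\<in>secant_dirs dX (fib y) g z e. \<exists>r. strict_mono r \<and> (us \<circ> r) \<longlonglongrightarrow> l" by blast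
qed

text \<open>Endpoints of the connected sets converge to points \<open>p\<close> and \<open>q\<close>
  of \<open>S\<close> at distance at least \<open>e\<close>. If these lay in different components of
  the compact set \<open>S\<close>, a clopen splitting of \<open>S\<close> would eventually split
  the approximating sets, and with them their connected subsets.\<close>

lemma wide_limit:
  assumes g: "continuous_map X.mtopology euclidean (g::'a \<Rightarrow> 'v::euclidean_space)" and y: "y \<in> MY"
    and ys: "limitin Y.mtopology ys y sequentially"
    and gs: "\<And>i x. x \<in> fib (ys i) \<Longrightarrow> dist (gs i x) (g x) \<le> \<delta> i" and d: "\<delta> \<longlonglongrightarrow> 0"
    and zs: "zs \<longlonglongrightarrow> z"
    and wide: "\<And>i::nat. wide (secant_dirs dX (fib (ys i)) (gs i) (zs i) e) e"
  shows "wide (secant_dirs dX (fib y) g z e) e"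
proof -
  define S where "S = secant_dirs dX (fib y) g z e"
  define Si where "Si i = secant_dirs dX (fib (ys i)) (gs i) (zs i) e" for i
  have S: "compact S" unfolding S_def using compact_secant_dirs[OF g y] .
  have sub: "\<exists>u r'. u \<in> S \<and> strict_mono r' \<and> (us \<circ> r') \<longlonglongrightarrow> u"
    if r: "strict_mono r" and us: "\<And>i. us i \<in> Si (r i)" for us and r :: "nat \<Rightarrow> nat"
  proof -
    have "limitin Y.mtopology (ys \<circ> r) y sequentially" using limitin_subsequence[OF r ys] .
    moreover have "(\<delta> \<circ> r) \<longlonglongrightarrow> 0" "(zs \<circ> r) \<longlonglongrightarrow> z" using LIMSEQ_subseq_LIMSEQ r d zs by blast+
    ultimately obtain u r' where "u \<in> secant_dirs dX (fib y) g z e" "strict_mono r'" "(us \<circ> r') \<longlonglongrightarrow> u"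
      using secant_dirs_limit[OF g, of "ys \<circ> r" y "gs \<circ> r" "\<delta> \<circ> r" "zs \<circ> r" z us e] us gs
      by (auto simp: Si_def)
    then show ?thesis unfolding S_def by blast
  qed
  \<comment> \<open>Upper semicontinuity: directions left outside \<open>W\<close> along a
    subsequence would accumulate at a point of \<open>S\<close> outside \<open>W\<close>.\<close>
  have ev: "\<forall>\<^sub>F i in sequentially. Si i \<subseteq> W" if W: "open W" "S \<subseteq> W" for W
  proof (rule ccontr)
    assume "\<not> ?thesis"
    then have "\<exists>\<^sub>F i in sequentially. \<not> Si i \<subseteq> W" by (simp add: not_eventually)
    then have "infinite {i. \<not> Si i \<subseteq> W}"
      by (simp add: frequently_cofinite flip: cofinite_eq_sequentially)
    then obtain r :: "nat \<Rightarrow> nat" where r: "strict_mono r" "\<And>i. r i \<in> {i. \<not> Si i \<subseteq> W}"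
      using infinite_enumerate by blast
    then have "\<forall>i. \<exists>u. u \<in> Si (r i) \<and> u \<notin> W" by blast
    then obtain us where us: "\<And>i. us i \<in> Si (r i)" "\<And>i. us i \<notin> W" by metis
    then obtain u r' where u: "u \<in> S" "strict_mono r'" "(us \<circ> r') \<longlonglongrightarrow> u" using sub[OF r(1)] by blast
    have "closed (- W)" "\<And>i. (us \<circ> r') i \<in> - W" using W(1) us(2) by auto
    then have "u \<in> - W" using u(3) by (rule closed_sequentially)
    then show False using u W by blast
  qed
  have "\<forall>i. \<exists>C p q. C \<subseteq> Si i \<and> connected C \<and> p \<in> C \<and> q \<in> C \<and> e \<le> dist p q"
    using wide unfolding wide_def Si_def by blast
  then obtain C ps qs where C: "\<And>i. C i \<subseteq> Si i" "\<And>i. connected (C i)" "\<And>i. ps i \<in> C i" "\<And>i. qs i \<in> C i"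
    "\<And>i. e \<le> dist (ps i) (qs i)" by metis
  obtain p r1 where p: "p \<in> S" "strict_mono r1" "(ps \<circ> r1) \<longlonglongrightarrow> p"
  proof -
    have "\<And>i. ps i \<in> Si (id i)" using C by auto
    then show ?thesis using sub[of id ps] strict_mono_id that by blast
  qed
  obtain q r2 where q: "q \<in> S" "strict_mono r2" "((qs \<circ> r1) \<circ> r2) \<longlonglongrightarrow> q"
  proof -
    have "\<And>i. (qs \<circ> r1) i \<in> Si (r1 i)" using C(1,4) unfolding o_def by blast
    then show ?thesis using sub[of r1 "qs \<circ> r1"] p(2) that by blast
  qed
  define r where "r = r1 \<circ> r2"
  have r: "strict_mono r" unfolding r_def using p(2) q(2) by (rule strict_mono_o)
  have lp: "(\<lambda>i. ps (r i)) \<longlonglongrightarrow> p" using LIMSEQ_subseq_LIMSEQ[OF p(3) q(2)] by (simp add: r_def o_def)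
  have lq: "(\<lambda>i. qs (r i)) \<longlonglongrightarrow> q" using q(3) by (simp add: r_def o_def)
  have far: "e \<le> dist p q"
    by (rule tendsto_lowerbound[OF tendsto_dist[OF lp lq]]) (use C(5) in auto)
  have "q \<in> connected_component_set S p"
  proof (rule ccontr)
    let ?P = "connected_component_set S p"
    assume nq: "q \<notin> ?P"
    have "locally compact S" using S by (simp add: closed_imp_locally_compact compact_imp_closed)
    moreover have c: "?P \<in> components S" using p(1) by (auto simp: components_def)
    moreover have "compact ?P" using S c by (rule compact_components)
    moreover have "open (- {q})" "?P \<subseteq> - {q}" using nq by auto
    ultimately obtain K where K: "openin (top_of_set S) K" "compact K" "?P \<subseteq> K" "K \<subseteq> - {q}"
      by (rule Sura_Bura_clopen_subset)
    obtain V where V: "open V" "K = S \<inter> V" using K(1) openin_open by metis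
    have "S - K = S - V" using V by auto
    then have "compact (S - K)" using S V(1) by (simp add: compact_diff)
    \<comment> \<open>The splitting of \<open>S\<close> into compact pieces is thickened to disjoint
      open sets, because the sets \<open>Si i\<close> are only near \<open>S\<close> and not inside
      it.\<close>
    then obtain U W where UW: "open U" "open W" "K \<subseteq> U" "S - K \<subseteq> W" "U \<inter> W = {}"
      using separation_normal_compact[OF K(2) compact_imp_closed] by (metis Diff_disjoint)
    have "p \<in> ?P" using connected_component_refl[OF p(1)] by simp
    then have pq: "p \<in> U" "q \<in> W" using UW K p(1) q(1) by blast+
    have "\<forall>\<^sub>F i in sequentially. Si i \<subseteq> U \<union> W" using ev UW by blast
    then have "\<forall>\<^sub>F i in sequentially. Si (r i) \<subseteq> U \<union> W" using r by (rule eventually_subseq[rotated])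
    moreover have "\<forall>\<^sub>F i in sequentially. ps (r i) \<in> U" "\<forall>\<^sub>F i in sequentially. qs (r i) \<in> W"
      using lp lq UW pq by (auto dest: topological_tendstoD)
    ultimately have "\<forall>\<^sub>F i in sequentially. Si (r i) \<subseteq> U \<union> W \<and> ps (r i) \<in> U \<and> qs (r i) \<in> W"
      by (intro eventually_conj)
    then obtain i where i: "Si (r i) \<subseteq> U \<union> W" "ps (r i) \<in> U" "qs (r i) \<in> W"
      using eventually_happens'[OF sequentially_bot] by blast
    have "C (r i) \<subseteq> U \<union> W" using C(1) i(1) by blast
    moreover have "U \<inter> W \<inter> C (r i) = {}" using UW(5) by blast
    ultimately have "U \<inter> C (r i) = {} \<or> W \<inter> C (r i) = {}"
      using connectedD[OF C(2)[of "r i"] UW(1,2)] by blast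
    then show False using i C(3,4) by blast
  qed
  moreover have "p \<in> connected_component_set S p" using connected_component_refl[OF p(1)] by simp
  ultimately show ?thesis
    unfolding wide_def S_def[symmetric] using far connected_connected_component connected_component_subset
    by blast
qed

text \<open>The bound \<open>R\<close> confines the points to a compact ball, so they need not be
  assumed convergent. For this reason tameness at scale \<open>e\<close> only tests \<open>z\<close>
  with \<open>norm z \<le> 1/e\<close>.\<close>

lemma wide_subsequence:
  assumes g: "continuous_map X.mtopology euclidean (g::'a \<Rightarrow> 'v::euclidean_space)" and y: "y \<in> MY"
    and ys: "\<And>i. ys i \<in> MY" "\<And>i::nat. dY y (ys i) < inverse (Suc i)"
    and gs: "\<And>i x. x \<in> fib (ys i) \<Longrightarrow> dist (gs i x) (g x) < inverse (Suc i)"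
    and zs: "\<And>i. norm (zs i) \<le> R"
    and wide: "\<And>i::nat. wide (secant_dirs dX (fib (ys i)) (gs i) (zs i) e) e"
  obtains z r where "strict_mono r" "(zs \<circ> r) \<longlonglongrightarrow> z" "norm z \<le> R" "wide (secant_dirs dX (fib y) g z e) e"
proof -
  have "\<And>i. zs i \<in> cball 0 R" using zs by simp
  then obtain z r where z: "z \<in> cball 0 R" "strict_mono r" "(zs \<circ> r) \<longlonglongrightarrow> z"
    using compact_cball[of "0::'v" R] unfolding compact_def by metis
  have "(\<lambda>i. dY (ys i) y) \<longlonglongrightarrow> 0"
    by (rule tendsto_sandwich[OF _ _ tendsto_const LIMSEQ_inverse_real_of_nat])
      (use ys(2) in \<open>auto simp: Y.commute intro!: always_eventually less_imp_le\<close>)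
  then have "limitin Y.mtopology ys y sequentially"
    using y ys by (auto simp: Y.limitin_metric_dist_null)
  then have "limitin Y.mtopology (ys \<circ> r) y sequentially" by (rule limitin_subsequence[OF z(2)])
  moreover have "((\<lambda>i. inverse (real (Suc i))) \<circ> r) \<longlonglongrightarrow> 0"
    using LIMSEQ_subseq_LIMSEQ[OF LIMSEQ_inverse_real_of_nat z(2)] .
  ultimately have "wide (secant_dirs dX (fib y) g z e) e"
    using z(3) gs wide
    by (intro wide_limit[OF g y, of "ys \<circ> r" "gs \<circ> r" "(\<lambda>i. inverse (real (Suc i))) \<circ> r" "zs \<circ> r"]) (auto intro: less_imp_le)
  with z that show ?thesis by auto
qed

text \<open>The gauge is \<open>s/3\<close>, where \<open>s\<close> is the supremum of the 1-Lipschitz cones of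
  height \<open>r y\<close> at \<open>y\<close>. A near-optimal \<open>y\<close> for \<open>s y'\<close> satisfies \<open>s y \<le> 2 r y\<close>, so that \<open>s \<le> 3 r y\<close>
  on the ball of radius \<open>r y\<close> around \<open>y\<close>.\<close>

lemma gauge_of_local_radii:
  fixes g :: "'a \<Rightarrow> 'v::metric_space"
  assumes loc: "\<And>y. y \<in> MY \<Longrightarrow> \<exists>r>0. r \<le> 1 \<and> (\<forall>g' y'. y' \<in> MY \<longrightarrow> dY y y' < r \<longrightarrow>
      (\<forall>x\<in>MX. dY y (f x) < r \<longrightarrow> dist (g' x) (g x) < r) \<longrightarrow> Q g' y')"
  obtains \<epsilon> where "gauge_fun X.mtopology \<epsilon>"
    "\<And>g' y. g' \<in> source_ball X.mtopology g \<epsilon> \<Longrightarrow> y \<in> MY \<Longrightarrow> Q g' y"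
proof -
  obtain r where r: "\<And>y. y \<in> MY \<Longrightarrow> 0 < r y" "\<And>y. y \<in> MY \<Longrightarrow> r y \<le> 1"
    "\<And>y g' y'. \<lbrakk>y \<in> MY; y' \<in> MY; dY y y' < r y; \<forall>x\<in>MX. dY y (f x) < r y \<longrightarrow> dist (g' x) (g x) < r y\<rbrakk> \<Longrightarrow> Q g' y'"
    using loc by metis
  define s where "s y' = (SUP y\<in>MY. r y - dY y y')" for y'
  have bdd: "bdd_above ((\<lambda>y. r y - dY y y') ` MY)" for y'
  proof (intro bdd_aboveI[of _ 1], clarify)
    fix y assume "y \<in> MY"
    then show "r y - dY y y' \<le> 1" using r(2)[of y] Y.nonneg[of y y'] by linarith
  qed
  have s_ge: "r y - dY y y' \<le> s y'" if "y \<in> MY" for y y'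
    unfolding s_def by (rule cSUP_upper[OF that bdd])
  have s_near: "\<exists>y\<in>MY. t < r y - dY y y'" if "y' \<in> MY" "t < s y'" for y' t
    using that less_cSUP_iff[OF _ bdd] unfolding s_def by blast
  have s_pos: "0 < s y" if "y \<in> MY" for y using s_ge[OF that, of y] r(1)[OF that] that by simp
  have s_le: "s y \<le> 1" if "y \<in> MY" for y
    unfolding s_def
  proof (rule cSUP_least)
    fix x assume "x \<in> MY"
    then show "r x - dY x y \<le> 1" using r(2)[of x] Y.nonneg[of x y] by linarith
  qed (use that in blast)
  have lip: "s b \<le> s a + dY a b" if "a \<in> MY" "b \<in> MY" for a b
    unfolding s_def[of b]
  proof (rule cSUP_least)
    fix y assume y: "y \<in> MY"
    have "dY y a \<le> dY y b + dY a b" using Y.triangle''[of y a b] Y.triangle[of y b a] Y.commute that y by metis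
    then show "r y - dY y b \<le> s a + dY a b" using s_ge[OF y, of a] by linarith
  qed (use that in blast)
  have "continuous_map Y.mtopology (Met_TC.mtopology) s"
  proof -
    have "\<exists>\<delta>>0. \<forall>x. x \<in> MY \<and> dY a x < \<delta> \<longrightarrow> dist (s a) (s x) < \<epsilon>" if "a \<in> MY" "\<epsilon> > 0" for a \<epsilon>
    proof (intro exI[of _ \<epsilon>] conjI allI impI)
      fix x assume x: "x \<in> MY \<and> dY a x < \<epsilon>"
      then show "dist (s a) (s x) < \<epsilon>"
        using lip[of a x] lip[of x a] that Y.commute[of a x] unfolding dist_real_def by linarith
    qed (use that in simp)
    then show ?thesis using Y.metric_continuous_map[OF Met_TC.Metric_space_axioms, of s] by auto
  qed
  then have cs: "continuous_map Y.mtopology euclideanreal s" by simp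
  have "continuous_map X.mtopology euclideanreal (s \<circ> f)"
    using continuous_map_compose[OF cont cs] .
  then have "gauge_fun X.mtopology (\<lambda>x. s (f x) / 3)"
    using s_pos s_le f_in unfolding gauge_fun_def o_def
    by (intro conjI continuous_map_real_mult_left ballI continuous_map_real_divide) (auto intro: order_trans[of _ 1])
  moreover have "Q g' y'" if g': "g' \<in> source_ball X.mtopology g (\<lambda>x. s (f x) / 3)" and y': "y' \<in> MY" for g' y'
  proof -
    obtain y where y: "y \<in> MY" "s y' / 2 < r y - dY y y'" using s_near[OF y', of "s y' / 2"] s_pos[OF y'] by auto
    have "s y \<le> s y' + dY y y'" using lip[OF y' y(1)] by (simp add: Y.commute)
    then have sy: "s y \<le> 2 * r y" using y(2) Y.nonneg[of y y'] by linarith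
    have "dist (g' x) (g x) < r y" if x: "x \<in> MX" "dY y (f x) < r y" for x
    proof -
      have "dist (g' x) (g x) < s (f x) / 3" using g' x by (simp add: source_ball_def)
      moreover have "s (f x) \<le> s y + dY y (f x)" using lip[OF y(1) f_in[OF x(1)]] .
      ultimately show ?thesis using sy x(2) by linarith
    qed
    moreover have "dY y y' < r y" using y(2) s_pos[OF y'] by linarith
    ultimately show ?thesis using r(3)[OF y(1) y'] by blast
  qed
  ultimately show ?thesis using that by blast
qed

end

subsection \<open>Baire category for the source limitation topology\<close>

text \<open>The classical nested-ball argument with gauges as radii. Halving the gauge at each step
  gives pointwise geometric bounds, and a closed ball of twice the new gauge inside
  \<open>G k\<close> keeps the limit in \<open>G k\<close>.\<close>

lemma source_limitation_baire:
  fixes h :: "'a \<Rightarrow> 'v::complete_space"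
  assumes op: "\<And>k h. h \<in> G k \<Longrightarrow> \<exists>\<epsilon>. gauge_fun X \<epsilon> \<and> source_ball X h \<epsilon> \<subseteq> G k"
    and dense: "\<And>(k::nat) h \<epsilon>. \<lbrakk>h \<in> maps_into X; gauge_fun X \<epsilon>\<rbrakk> \<Longrightarrow> \<exists>g\<in>source_ball X h \<epsilon>. g \<in> G k"
    and h: "h \<in> maps_into X" and \<epsilon>: "gauge_fun X \<epsilon>"
  shows "\<exists>g\<in>source_ball X h \<epsilon>. \<forall>k. g \<in> G k"
proof -
  define P where "P = (\<lambda>(h::'a \<Rightarrow> 'v, \<epsilon>). h \<in> maps_into X \<and> gauge_fun X \<epsilon>)"
  define Q where "Q k = (\<lambda>(h::'a \<Rightarrow> 'v, \<epsilon>) (h', \<epsilon>'). h' \<in> source_ball X h \<epsilon> \<and> (\<forall>x\<in>topspace X. \<epsilon>' x \<le> \<epsilon> x / 2) \<and>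
     (\<forall>g\<in>maps_into X. (\<forall>x\<in>topspace X. dist (g x) (h' x) \<le> 2 * \<epsilon>' x) \<longrightarrow> g \<in> G k))" for k
  have step: "\<exists>s'. P s' \<and> Q k s s'" if Ps: "P s" for s k
  proof -
    obtain h \<epsilon> where s: "s = (h, \<epsilon>)" "h \<in> maps_into X" "gauge_fun X \<epsilon>"
      using Ps unfolding P_def by (cases s) auto
    obtain h' where h': "h' \<in> source_ball X h \<epsilon>" "h' \<in> G k" using dense s by blast
    obtain \<eta> where \<eta>: "gauge_fun X \<eta>" "source_ball X h' \<eta> \<subseteq> G k" using op h' by blast
    \<comment> \<open>The third leaves \<open>2 * \<epsilon>'\<close> strictly below
      \<open>\<eta>\<close>, so the closed ball of that radius fits into the open
      \<open>\<eta>\<close>-ball.\<close>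
    define \<epsilon>' where "\<epsilon>' x = min (\<epsilon> x / 2) (\<eta> x / 3)" for x
    have "gauge_fun X \<epsilon>'"
      using s(3) \<eta>(1) unfolding gauge_fun_def \<epsilon>'_def
      by (auto intro!: continuous_map_real_min continuous_map_real_divide intro: min.coboundedI1)
    moreover have "2 * \<epsilon>' x < \<eta> x" if "x \<in> topspace X" for x
      using that \<eta>(1) by (auto simp: \<epsilon>'_def gauge_fun_def min_def)
    then have "g \<in> G k" if "g \<in> maps_into X" "\<forall>x\<in>topspace X. dist (g x) (h' x) \<le> 2 * \<epsilon>' x" for g
      using that \<eta>(2) by (force simp: source_ball_def)
    moreover have "\<epsilon>' x \<le> \<epsilon> x / 2" for x by (simp add: \<epsilon>'_def)
    ultimately show ?thesis using h'(1) s
      by (intro exI[of _ "(h', \<epsilon>')"]) (auto simp: P_def Q_def source_ball_def)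
  qed
  \<comment> \<open>All later maps stay within twice the initial gauge, so starting with a third
    puts the limit within \<open>2 \<epsilon> / 3 < \<epsilon>\<close> of \<open>h\<close>.\<close>
  have "gauge_fun X (\<lambda>x. \<epsilon> x / 3)"
    using \<epsilon> unfolding gauge_fun_def by (force intro!: continuous_map_real_divide)
  then have P0: "P (h, \<lambda>x. \<epsilon> x / 3)" using h by (simp add: P_def)
  have "\<exists>s. \<forall>k. (P (s k) \<and> (k = 0 \<longrightarrow> s k = (h, \<lambda>x. \<epsilon> x / 3))) \<and> Q k (s k) (s (Suc k))"
  proof (rule dependent_nat_choice)
    show "\<exists>s. P s \<and> (0 = 0 \<longrightarrow> s = (h, \<lambda>x. \<epsilon> x / 3))" using P0 by blast
    fix s and k :: nat assume "P s \<and> (k = 0 \<longrightarrow> s = (h, \<lambda>x. \<epsilon> x / 3))"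
    then show "\<exists>s'. (P s' \<and> (Suc k = 0 \<longrightarrow> s' = (h, \<lambda>x. \<epsilon> x / 3))) \<and> Q k s s'"
      using step by auto
  qed
  then obtain s where s: "\<And>k. P (s k)" "s 0 = (h, \<lambda>x. \<epsilon> x / 3)" "\<And>k. Q k (s k) (s (Suc k))" by blast
  define H where "H k = fst (s k)" for k
  define E where "E k = snd (s k)" for k
  have sk: "s k = (H k, E k)" for k by (simp add: H_def E_def)
  have HE: "H k \<in> maps_into X" "gauge_fun X (E k)" for k using s(1)[of k] unfolding sk P_def by auto
  have step': "\<And>x. x \<in> topspace X \<Longrightarrow> dist (H (Suc k) x) (H k x) < E k x"
    "\<And>x. x \<in> topspace X \<Longrightarrow> E (Suc k) x \<le> E k x / 2"
    "\<And>g. g \<in> maps_into X \<Longrightarrow> (\<forall>x\<in>topspace X. dist (g x) (H (Suc k) x) \<le> 2 * E (Suc k) x) \<Longrightarrow> g \<in> G k" for k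
    using s(3)[of k] unfolding sk Q_def by (auto simp: source_ball_def)
  have Epos: "0 < E k x" "E k x \<le> 1" if "x \<in> topspace X" for k x
    using HE(2)[of k] that by (auto simp: gauge_fun_def)
  have tail: "dist (H (k + i) x) (H k x) + 2 * E (k + i) x \<le> 2 * E k x" if x: "x \<in> topspace X" for k i x
  proof (induction i)
    case (Suc i)
    have "dist (H (k + Suc i) x) (H k x) \<le> dist (H (Suc (k + i)) x) (H (k + i) x) + dist (H (k + i) x) (H k x)"
      by (simp add: dist_triangle)
    then show ?case using Suc step'(1)[OF x, of "k+i"] step'(2)[OF x, of "k+i"] by auto
  qed simp
  \<comment> \<open>Gauges are bounded by 1, so the decay is uniform in \<open>x\<close>; the
    convergence is therefore uniform and the limit continuous.\<close>
  have Esmall: "E k x \<le> (1/2) ^ k" if x: "x \<in> topspace X" for k x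
  proof (induction k)
    case (Suc k)
    then show ?case using step'(2)[OF x, of k] by simp
  qed (use Epos x in simp)
  have near: "dist (H j x) (H k x) \<le> 2 * E k x" if "x \<in> topspace X" "k \<le> j" for x j k
    using tail[OF that(1), of k "j - k"] Epos(1)[OF that(1), of j] that(2) by simp
  have conv: "convergent (\<lambda>k. H k x)" if x: "x \<in> topspace X" for x
  proof -
    have "Cauchy (\<lambda>k. H k x)"
    proof (rule metric_CauchyI)
      fix e :: real assume "e > 0"
      then obtain N where N: "(1/2) ^ N < e / 4" using real_arch_pow_inv[of "e/4" "1/2"] by auto
      have "dist (H m x) (H n x) < e" if "m \<ge> N" "n \<ge> N" for m n
      proof -
        have "dist (H m x) (H n x) \<le> dist (H m x) (H N x) + dist (H n x) (H N x)"
          by (rule dist_triangle2)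
        then show ?thesis using near[OF x that(1)] near[OF x that(2)] Esmall[OF x, of N] N by linarith
      qed
      then show "\<exists>N. \<forall>m\<ge>N. \<forall>n\<ge>N. dist (H m x) (H n x) < e" by blast
    qed
    then show ?thesis by (rule Cauchy_convergent)
  qed
  define g where "g = restrict (\<lambda>x. lim (\<lambda>k. H k x)) (topspace X)"
  have lim: "(\<lambda>k. H k x) \<longlonglongrightarrow> g x" if "x \<in> topspace X" for x
    using conv[OF that] that by (simp add: g_def convergent_LIMSEQ_iff)
  have gH: "dist (g x) (H k x) \<le> 2 * E k x" if x: "x \<in> topspace X" for x k
    by (rule tendsto_upperbound[OF tendsto_dist[OF lim[OF x] tendsto_const]])
      (use near[OF x] in \<open>auto simp: eventually_sequentially\<close>)
  have "continuous_map X Met_TC.mtopology g"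
  proof (rule Met_TC.continuous_map_uniform_limit)
    show "\<forall>\<^sub>F k in sequentially. continuous_map X Met_TC.mtopology (H k)"
      using HE(1) by (simp add: maps_into_def)
    fix e :: real assume "e > 0"
    then obtain N where N: "(1/2) ^ N < e / 2" using real_arch_pow_inv[of "e/2" "1/2"] by auto
    have "dist (H k x) (g x) < e" if "k \<ge> N" "x \<in> topspace X" for k x
    proof -
      have "(1/2::real) ^ k \<le> (1/2) ^ N" using that(1) by (intro power_decreasing) auto
      then show ?thesis
        using gH[OF that(2), of k] Esmall[OF that(2), of k] N dist_commute[of "H k x" "g x"] by linarith
    qed
    then show "\<forall>\<^sub>F k in sequentially. \<forall>x\<in>topspace X. g x \<in> UNIV \<and> dist (H k x) (g x) < e"
      by (auto simp: eventually_sequentially)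
  qed simp
  then have gm: "g \<in> maps_into X" by (simp add: maps_into_def g_def)
  have "g \<in> source_ball X h \<epsilon>"
    unfolding source_ball_def
  proof (intro CollectI conjI ballI gm)
    fix x assume x: "x \<in> topspace X"
    have "H 0 = h" "E 0 x = \<epsilon> x / 3" using s(2) by (auto simp: H_def E_def)
    then show "dist (g x) (h x) < \<epsilon> x" using gH[OF x, of 0] \<epsilon> x by (auto simp: gauge_fun_def)
  qed
  moreover have "g \<in> G k" for k using step'(3)[OF gm, of k] gH by blast
  ultimately show ?thesis by blast
qed

subsection \<open>Approximation by maps in general position\<close>

text \<open>The points lie in a translate of a span of \<open>card T - 1\<close> vectors, a proper
  subspace. For empty \<open>T\<close> there are none, as the weights would sum to 0.\<close>

lemma negligible_affine_combinations:
  fixes p :: "'i \<Rightarrow> 'v::euclidean_space"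
  assumes "finite T" "card T \<le> DIM('v)"
  shows "negligible {\<Sum>j\<in>T. w j *\<^sub>R p j |w. sum w T = (1::real)}" (is "negligible ?A")
proof (cases "T = {}")
  case False
  then obtain j0 where j0: "j0 \<in> T" by blast
  define B where "B = (\<lambda>j. p j - p j0) ` (T - {j0})"
  have "dim (span B) \<le> card B" using assms by (simp add: B_def dim_le_card')
  also have "\<dots> \<le> card (T - {j0})" unfolding B_def using assms by (intro card_image_le) simp
  also have "\<dots> < card T" using assms j0 by (intro psubset_card_mono) auto
  finally have "negligible (span B)" using assms by (intro negligible_lowdim) simp
  then have "negligible ((+) (p j0) ` span B)" by (rule negligible_translation)
  moreover have "?A \<subseteq> (+) (p j0) ` span B"
  proof clarify
    fix w :: "'i \<Rightarrow> real" assume w: "sum w T = 1"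
    have "(\<Sum>j\<in>T. w j *\<^sub>R p j) - p j0 = (\<Sum>j\<in>T. w j *\<^sub>R p j) - sum w T *\<^sub>R p j0"
      by (simp add: w)
    also have "\<dots> = (\<Sum>j\<in>T. w j *\<^sub>R (p j - p j0))"
      by (simp add: scaleR_sum_left sum_subtractf scaleR_diff_right)
    also have "\<dots> = (\<Sum>j\<in>T - {j0}. w j *\<^sub>R (p j - p j0))"
      using assms j0 by (subst sum.remove[of T j0]) auto
    also have "\<dots> \<in> span B" unfolding B_def
      by (intro span_sum span_scale span_base) auto
    finally show "(\<Sum>j\<in>T. w j *\<^sub>R p j) \<in> (+) (p j0) ` span B"
      by (metis add.commute diff_add_cancel image_eqI)
  qed
  ultimately show ?thesis by (rule negligible_subset)
qed simp

text \<open>Affine independence of any \<open>DIM('v) + 1\<close> or fewer members. Coefficients are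
  indexed by \<open>I\<close> and not by the values of \<open>p\<close>, so that coinciding points
  count as dependent.\<close>

definition in_general_position :: "'i set \<Rightarrow> ('i \<Rightarrow> 'v::euclidean_space) \<Rightarrow> bool" where
  "in_general_position I p \<longleftrightarrow> (\<forall>c. card {i\<in>I. c i \<noteq> 0} \<le> DIM('v) + 1 \<and> sum c I = 0 \<and>
     (\<Sum>i\<in>I. c i *\<^sub>R p i) = 0 \<longrightarrow> (\<forall>i\<in>I. c i = (0::real)))"

text \<open>Points are added one at a time. A new point has to avoid only finitely many affine hulls
  of at most \<open>DIM('v)\<close> earlier points, a null set that cannot contain a ball.\<close>

lemma general_position_dense:
  fixes q :: "'i \<Rightarrow> 'v::euclidean_space"
  assumes "finite I" "\<delta> > 0"
  obtains p where "\<And>i. i \<in> I \<Longrightarrow> dist (p i) (q i) < \<delta>" "in_general_position I p"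
proof -
  have "\<exists>p. (\<forall>i\<in>I. dist (p i) (q i) < \<delta>) \<and> in_general_position I p"
    using \<open>finite I\<close>
  proof (induction I)
    case (insert i I)
    then obtain p where p: "\<And>i. i \<in> I \<Longrightarrow> dist (p i) (q i) < \<delta>" "in_general_position I p" by blast
    define N where "N = (\<Union>T\<in>{T. T \<subseteq> I \<and> card T \<le> DIM('v)}. {\<Sum>j\<in>T. w j *\<^sub>R p j |w. sum w T = (1::real)})"
    have "negligible N"
      unfolding N_def
    proof (intro negligible_Union finite_imageI)
      show "finite {T. T \<subseteq> I \<and> card T \<le> DIM('v)}" using insert by simp
    next
      fix t assume "t \<in> (\<lambda>T. {\<Sum>j\<in>T. w j *\<^sub>R p j |w. sum w T = (1::real)}) ` {T. T \<subseteq> I \<and> card T \<le> DIM('v)}"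
      then obtain T where "t = {\<Sum>j\<in>T. w j *\<^sub>R p j |w. sum w T = (1::real)}" "T \<subseteq> I" "card T \<le> DIM('v)" by blast
      then show "negligible t"
        using negligible_affine_combinations[of T p] insert(1) finite_subset by auto
    qed
    moreover have "\<not> negligible (ball (q i) \<delta>)" using assms by (intro open_not_negligible) auto
    ultimately have "\<not> ball (q i) \<delta> \<subseteq> N" using negligible_subset by blast
    then obtain a where "a \<in> ball (q i) \<delta>" and aN: "a \<notin> N" by blast
    then have a: "dist a (q i) < \<delta>" by (simp add: dist_commute)
    define p' where "p' = p(i := a)"
    have p': "p' i = a" "\<And>j. j \<in> I \<Longrightarrow> p' j = p j" using insert by (auto simp: p'_def)
    have "in_general_position (insert i I) p'"
      unfolding in_general_position_def
    proof (intro allI impI, elim conjE)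
      fix c assume c: "card {j \<in> insert i I. c j \<noteq> 0} \<le> DIM('v) + 1" "sum c (insert i I) = 0"
        "(\<Sum>j\<in>insert i I. c j *\<^sub>R p' j) = 0"
      have s: "c i + sum c I = 0" "c i *\<^sub>R a + (\<Sum>j\<in>I. c j *\<^sub>R p j) = 0"
        using c(2,3) insert(1,2) p' by (auto cong: sum.cong)
      have "c i = 0"
      proof (rule ccontr)
        assume ci: "c i \<noteq> 0"
        \<comment> \<open>Solving the dependence for \<open>a\<close> writes it as an affine
          combination over \<open>T\<close>. The support loses the index \<open>i\<close>, so
          \<open>card T \<le> DIM('v)\<close> and \<open>a\<close> would lie in
          \<open>N\<close>.\<close>
        define T where "T = {j \<in> I. c j \<noteq> 0}"
        have "{j \<in> insert i I. c j \<noteq> 0} = insert i T" using ci by (auto simp: T_def)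
        moreover have "i \<notin> T" "finite T" using insert by (auto simp: T_def)
        ultimately have "card T \<le> DIM('v)" using c(1) by simp
        define w where "w j = - c j / c i" for j
        have T: "sum h I = sum h T" if "\<And>j. c j = 0 \<Longrightarrow> h j = 0" for h :: "'i \<Rightarrow> 'b::comm_monoid_add"
          using insert(1) that by (intro sum.mono_neutral_right) (auto simp: T_def)
        have "sum w T = - sum c I / c i"
          unfolding w_def by (simp add: T sum_divide_distrib sum_negf)
        moreover have "- sum c I = c i" using s(1) by linarith
        ultimately have "sum w T = 1" using ci by simp
        moreover have "a = (\<Sum>j\<in>T. w j *\<^sub>R p j)"
        proof -
          have "(\<Sum>j\<in>T. w j *\<^sub>R p j) = (- 1 / c i) *\<^sub>R (\<Sum>j\<in>I. c j *\<^sub>R p j)"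
            by (subst T) (auto simp: w_def scaleR_sum_right)
          also have "\<dots> = (- 1 / c i) *\<^sub>R (- (c i *\<^sub>R a))"
            by (simp only: eq_neg_iff_add_eq_0[THEN iffD2, OF s(2)[unfolded add.commute[of "c i *\<^sub>R a"]]])
          finally show ?thesis using ci by simp
        qed
        ultimately have "a \<in> {\<Sum>j\<in>T. w j *\<^sub>R p j |w. sum w T = (1::real)}" by blast
        moreover have "T \<in> {T. T \<subseteq> I \<and> card T \<le> DIM('v)}" using \<open>card T \<le> DIM('v)\<close> by (simp add: T_def)
        ultimately have "a \<in> N" unfolding N_def by (rule UN_I[rotated])
        then show False using aN by blast
      qed
      then have "{j \<in> insert i I. c j \<noteq> 0} = {j \<in> I. c j \<noteq> 0}" by auto
      then have "card {j \<in> I. c j \<noteq> 0} \<le> DIM('v) + 1 \<and> sum c I = 0 \<and> (\<Sum>j\<in>I. c j *\<^sub>R p j) = 0"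
        using c(1) s \<open>c i = 0\<close> by simp
      then have "\<forall>j\<in>I. c j = 0"
        by (rule p(2)[unfolded in_general_position_def, THEN spec, THEN mp])
      then show "\<forall>j\<in>insert i I. c j = 0" using \<open>c i = 0\<close> by simp
    qed
    moreover have "\<forall>j\<in>insert i I. dist (p' j) (q j) < \<delta>" using a p p' by simp
    ultimately show ?case by blast
  qed (simp add: in_general_position_def)
  then show ?thesis using that by blast
qed

text \<open>The affine dependence \<open>(s' - s)(r' x - r x') = (r' - r)(s' y - s y')\<close> holds since both sides are
  \<open>(r' - r)(s' - s) z\<close>; it avoids dividing by differences that are not yet known to be nonzero.\<close>

lemma secant_through_point_unique:
  fixes p :: "'i \<Rightarrow> 'v::euclidean_space"
  assumes gp: "in_general_position V p" and V: "finite V" and dim: "2 * n + 1 \<le> DIM('v)"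
    and IJ: "I \<inter> J = {}" "card I \<le> n + 1" "card J \<le> n + 1"
    and supp: "{i\<in>V. a i \<noteq> 0} = I" "{i\<in>V. a' i \<noteq> 0} = J" "{i\<in>V. b i \<noteq> 0} = I" "{i\<in>V. b' i \<noteq> 0} = J"
    and one: "sum a V = 1" "sum a' V = 1" "sum b V = 1" "sum b' V = (1::real)"
    and sec: "(\<Sum>i\<in>V. a i *\<^sub>R p i) - z = r *\<^sub>R u" "(\<Sum>i\<in>V. a' i *\<^sub>R p i) - z = r' *\<^sub>R u"
      "(\<Sum>i\<in>V. b i *\<^sub>R p i) - z = s *\<^sub>R v" "(\<Sum>i\<in>V. b' i *\<^sub>R p i) - z = s' *\<^sub>R v"
    and nz: "r' \<noteq> 0" "s' \<noteq> 0"
  shows "(\<Sum>i\<in>V. a i *\<^sub>R p i) = (\<Sum>i\<in>V. b i *\<^sub>R p i)"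
proof -
  have fin: "finite I" "finite J" using V supp by auto
  \<comment> \<open>The dimension bound enters here: two carriers have at most
    \<open>2 * n + 2 \<le> DIM('v) + 1\<close> vertices, so general position kills every dependence
    supported on them.\<close>
  have indep: "c i = 0" if "\<And>i. i \<in> V \<Longrightarrow> i \<notin> I \<Longrightarrow> i \<notin> J \<Longrightarrow> c i = 0" "sum c V = 0"
    "(\<Sum>i\<in>V. c i *\<^sub>R p i) = 0" "i \<in> V" for c i
  proof -
    have "card {i\<in>V. c i \<noteq> 0} \<le> card (I \<union> J)"
      using that(1) fin by (intro card_mono) auto
    also have "\<dots> \<le> card I + card J" by (rule card_Un_le)
    finally have "card {i\<in>V. c i \<noteq> 0} \<le> DIM('v) + 1" using IJ dim by linarith
    then show ?thesis using gp that unfolding in_general_position_def by blast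
  qed
  have off: "i \<in> V \<Longrightarrow> i \<notin> I \<Longrightarrow> a i = 0" "i \<in> V \<Longrightarrow> i \<notin> J \<Longrightarrow> a' i = 0"
    "i \<in> V \<Longrightarrow> i \<notin> I \<Longrightarrow> b i = 0" "i \<in> V \<Longrightarrow> i \<notin> J \<Longrightarrow> b' i = 0" for i
    using supp by blast+
  have IV: "I \<subseteq> V" "J \<subseteq> V" using supp by auto
  \<comment> \<open>Points with disjoint carriers differ: otherwise their coefficients would agree
    and so vanish everywhere. This yields \<open>r \<noteq> r'\<close> and
    \<open>s \<noteq> s'\<close>.\<close>
  have ne: "(\<Sum>i\<in>V. x i *\<^sub>R p i) \<noteq> (\<Sum>i\<in>V. x' i *\<^sub>R p i)"
    if x: "\<And>i. i \<in> V \<Longrightarrow> i \<notin> I \<Longrightarrow> x i = 0" "\<And>i. i \<in> V \<Longrightarrow> i \<notin> J \<Longrightarrow> x' i = 0" "sum x V = 1" "sum x' V = 1" for x x'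
  proof
    assume eq: "(\<Sum>i\<in>V. x i *\<^sub>R p i) = (\<Sum>i\<in>V. x' i *\<^sub>R p i)"
    have eq': "x i - x' i = 0" if "i \<in> V" for i
      by (rule indep[of "\<lambda>i. x i - x' i"]) (use that x eq in \<open>auto simp: sum_subtractf scaleR_diff_left\<close>)
    have "x i = 0" if "i \<in> V" for i
      using eq'[OF that] x(1,2)[OF that] IJ(1) by (cases "i \<in> I") auto
    then show False using x(3) by simp
  qed
  have rr: "r \<noteq> r'"
  proof
    assume "r = r'"
    then have "(\<Sum>i\<in>V. a i *\<^sub>R p i) - z = (\<Sum>i\<in>V. a' i *\<^sub>R p i) - z" using sec(1,2) by simp
    then show False using ne[of a a'] off one by simp
  qed
  have ss: "s \<noteq> s'"
  proof
    assume "s = s'"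
    then have "(\<Sum>i\<in>V. b i *\<^sub>R p i) - z = (\<Sum>i\<in>V. b' i *\<^sub>R p i) - z" using sec(3,4) by simp
    then show False using ne[of b b'] off one by simp
  qed
  define c where "c i = (s' - s) * (r' * a i - r * a' i) - (r' - r) * (s' * b i - s * b' i)" for i
  have "sum c V = (s' - s) * (r' * sum a V - r * sum a' V) - (r' - r) * (s' * sum b V - s * sum b' V)"
    by (simp add: c_def sum_subtractf flip: sum_distrib_left)
  then have c1: "sum c V = 0" by (simp add: one)
  have "(\<Sum>i\<in>V. c i *\<^sub>R p i) = (s' - s) *\<^sub>R (r' *\<^sub>R (\<Sum>i\<in>V. a i *\<^sub>R p i) - r *\<^sub>R (\<Sum>i\<in>V. a' i *\<^sub>R p i))
     - (r' - r) *\<^sub>R (s' *\<^sub>R (\<Sum>i\<in>V. b i *\<^sub>R p i) - s *\<^sub>R (\<Sum>i\<in>V. b' i *\<^sub>R p i))"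
    by (simp add: c_def scaleR_sum_right sum_subtractf algebra_simps sum.distrib)
  also have "\<dots> = 0"
  proof -
    have "(\<Sum>i\<in>V. a i *\<^sub>R p i) = z + r *\<^sub>R u" "(\<Sum>i\<in>V. a' i *\<^sub>R p i) = z + r' *\<^sub>R u"
      "(\<Sum>i\<in>V. b i *\<^sub>R p i) = z + s *\<^sub>R v" "(\<Sum>i\<in>V. b' i *\<^sub>R p i) = z + s' *\<^sub>R v"
      using sec by (auto simp: algebra_simps)
    then show ?thesis by (simp add: algebra_simps)
  qed
  finally have c2: "(\<Sum>i\<in>V. c i *\<^sub>R p i) = 0" .
  have c0: "c i = 0" if "i \<in> V" for i
    by (rule indep[of c]) (use that off c1 c2 in \<open>auto simp: c_def\<close>)
  \<comment> \<open>On \<open>I\<close> the coefficients \<open>a'\<close> and \<open>b'\<close>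
    vanish, so \<open>c i = 0\<close> makes \<open>a\<close> and \<open>b\<close> proportional
    there. Both sum to 1 over \<open>I\<close>, hence the two factors are equal and can be
    cancelled.\<close>
  have I: "(s' - s) * r' * a i = (r' - r) * s' * b i" if "i \<in> I" for i
  proof -
    have "i \<in> V" "i \<notin> J" using that IV IJ(1) by auto
    then show ?thesis using c0[of i] off(2,4)[of i] by (simp add: c_def)
  qed
  have sI: "sum a I = 1" "sum b I = 1"
    using sum.mono_neutral_left[OF V IV(1), of a] sum.mono_neutral_left[OF V IV(1), of b] one off(1,3) by auto
  have "(s' - s) * r' * sum a I = (r' - r) * s' * sum b I"
    unfolding sum_distrib_left using I by (rule sum.cong[OF refl])
  then have "(s' - s) * r' = (r' - r) * s'" by (simp add: sI)
  moreover have "(s' - s) * r' \<noteq> 0" using ss nz by simp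
  ultimately have "a i = b i" if "i \<in> V" for i
    using I[of i] off(1,3)[OF that] by (cases "i \<in> I") auto
  then show ?thesis by simp
qed

text \<open>Directions are sorted by the pair of carriers of their two witnesses. There are finitely
  many pairs, and for each the line through \<open>z\<close> is unique, leaving at most
  \<open>u\<close> and \<open>-u\<close>.\<close>

lemma finite_secant_dirs:
  fixes p :: "'i \<Rightarrow> 'v::euclidean_space" and l :: "'a \<Rightarrow> 'i \<Rightarrow> real"
  assumes gp: "in_general_position V p" and V: "finite V" and dim: "2 * n + 1 \<le> DIM('v)" and e: "e > 0"
    and l: "\<And>x. x \<in> K \<Longrightarrow> sum (l x) V = 1" "\<And>x. x \<in> K \<Longrightarrow> g x = (\<Sum>i\<in>V. l x i *\<^sub>R p i)"
      "\<And>x. x \<in> K \<Longrightarrow> card {i\<in>V. l x i \<noteq> 0} \<le> n + 1"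
    and far: "\<And>x x'. x \<in> K \<Longrightarrow> x' \<in> K \<Longrightarrow> e \<le> d x x' \<Longrightarrow> {i\<in>V. l x i \<noteq> 0} \<inter> {i\<in>V. l x' i \<noteq> 0} = {}"
  shows "finite (secant_dirs d K g z e)"
proof -
  define S where "S I J = {u. norm u = 1 \<and> (\<exists>x\<in>K. \<exists>x'\<in>K. e \<le> d x x' \<and>
     e \<le> dist (g x) z \<and> e \<le> dist (g x') z \<and>
     g x - z = ((g x - z) \<bullet> u) *\<^sub>R u \<and> g x' - z = ((g x' - z) \<bullet> u) *\<^sub>R u \<and>
     {i\<in>V. l x i \<noteq> 0} = I \<and> {i\<in>V. l x' i \<noteq> 0} = J)}" for I J
  have nz: "(g x - z) \<bullet> u \<noteq> 0" if "e \<le> dist (g x) z" "g x - z = ((g x - z) \<bullet> u) *\<^sub>R u" for x u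
  proof
    assume "(g x - z) \<bullet> u = 0"
    then have "g x = z" using that(2) by (metis right_minus_eq scaleR_zero_left)
    then show False using that(1) e by simp
  qed
  have "u = v \<or> u = - v" if u: "u \<in> S I J" and v: "v \<in> S I J" for u v I J
  proof -
    obtain x x' where x: "norm u = 1" "x \<in> K" "x' \<in> K" "e \<le> d x x'" "e \<le> dist (g x) z" "e \<le> dist (g x') z"
     "g x - z = ((g x - z) \<bullet> u) *\<^sub>R u" "g x' - z = ((g x' - z) \<bullet> u) *\<^sub>R u"
     "{i\<in>V. l x i \<noteq> 0} = I" "{i\<in>V. l x' i \<noteq> 0} = J" using u unfolding S_def by blast
    obtain y y' where y: "norm v = 1" "y \<in> K" "y' \<in> K" "e \<le> d y y'" "e \<le> dist (g y) z" "e \<le> dist (g y') z"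
     "g y - z = ((g y - z) \<bullet> v) *\<^sub>R v" "g y' - z = ((g y' - z) \<bullet> v) *\<^sub>R v"
     "{i\<in>V. l y i \<noteq> 0} = I" "{i\<in>V. l y' i \<noteq> 0} = J" using v unfolding S_def by blast
    have "(\<Sum>i\<in>V. l x i *\<^sub>R p i) = (\<Sum>i\<in>V. l y i *\<^sub>R p i)"
    proof (rule secant_through_point_unique[OF gp V dim _ _ _ x(9,10) y(9,10) _ _ _ _ x(7)[unfolded l(2)[OF x(2)]]
          x(8)[unfolded l(2)[OF x(3)]] y(7)[unfolded l(2)[OF y(2)]] y(8)[unfolded l(2)[OF y(3)]]])
      show "I \<inter> J = {}" using far[OF x(2,3,4)] x(9,10) by simp
      show "card I \<le> n + 1" "card J \<le> n + 1" using l(3)[OF x(2)] l(3)[OF x(3)] x(9,10) by auto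
      show "((\<Sum>i\<in>V. l x' i *\<^sub>R p i) - z) \<bullet> u \<noteq> 0" using nz[OF x(6,8)] l(2)[OF x(3)] by simp
      show "((\<Sum>i\<in>V. l y' i *\<^sub>R p i) - z) \<bullet> v \<noteq> 0" using nz[OF y(6,8)] l(2)[OF y(3)] by simp
    qed (use l(1) x y in auto)
    then have "g x = g y" using l(2) x(2) y(2) by simp
    then obtain r s where rs: "r *\<^sub>R u = s *\<^sub>R v" "r \<noteq> 0" using x(7) y(7) nz[OF x(5,7)] by metis
    then have "\<bar>r\<bar> = \<bar>s\<bar>" using x(1) y(1) by (metis mult.right_neutral norm_scaleR)
    then have "r = s \<or> r = - s" by linarith
    then show ?thesis
    proof
      assume "r = s" then show ?thesis using rs by simp
    next
      assume "r = - s"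
      then have "s *\<^sub>R (- u) = s *\<^sub>R v" "s \<noteq> 0" using rs by auto
      then have "- u = v" by (metis scaleR_cancel_left)
      then show ?thesis by auto
    qed
  qed
  then have "finite (S I J)" for I J
  proof (cases "S I J = {}")
    case False
    then obtain v where "v \<in> S I J" by blast
    with \<open>\<And>v u J I. u \<in> S I J \<Longrightarrow> v \<in> S I J \<Longrightarrow> u = v \<or> u = - v\<close> have "S I J \<subseteq> {v, - v}" by blast
    then show ?thesis by (rule finite_subset) simp
  qed simp
  then have "finite (\<Union>(I, J)\<in>Pow V \<times> Pow V. S I J)"
    using V by (intro finite_UN_I finite_cartesian_product) auto
  moreover have "secant_dirs d K g z e \<subseteq> (\<Union>(I, J)\<in>Pow V \<times> Pow V. S I J)"
  proof
    fix u assume "u \<in> secant_dirs d K g z e"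
    then obtain x x' where "norm u = 1 \<and> x \<in> K \<and> x' \<in> K \<and> e \<le> d x x' \<and>
       e \<le> dist (g x) z \<and> e \<le> dist (g x') z \<and>
       g x - z = ((g x - z) \<bullet> u) *\<^sub>R u \<and> g x' - z = ((g x' - z) \<bullet> u) *\<^sub>R u"
      unfolding secant_dirs_def by blast
    then have "u \<in> S {i\<in>V. l x i \<noteq> 0} {i\<in>V. l x' i \<noteq> 0}" unfolding S_def by blast
    then show "u \<in> (\<Union>(I, J)\<in>Pow V \<times> Pow V. S I J)"
      by (intro UN_I[of "({i\<in>V. l x i \<noteq> 0}, {i\<in>V. l x' i \<noteq> 0})"]) auto
  qed
  ultimately show ?thesis by (rule finite_subset[rotated])
qed

section \<open>Continuous real functions on spaces\<close>

lemma (in Metric_space) zero_set_function: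
  assumes C: "closedin mtopology C"
  obtains \<phi> where "continuous_map mtopology euclideanreal \<phi>" "\<And>x. x \<in> M \<Longrightarrow> 0 \<le> \<phi> x"
    "\<And>x. x \<in> M \<Longrightarrow> \<phi> x = 0 \<longleftrightarrow> x \<in> C"
proof (cases "C = {}")
  case True
  then show ?thesis by (intro that[of "\<lambda>_. 1"]) auto
next
  case False
  have CM: "C \<subseteq> M" using closedin_subset[OF C] by simp
  define \<phi> where "\<phi> x = (INF a\<in>C. d x a)" for x
  have bdd: "bdd_below (d x ` C)" for x by (intro bdd_belowI[of _ 0]) auto
  have le: "\<phi> x \<le> d x a" if "a \<in> C" for x a unfolding \<phi>_def by (rule cINF_lower[OF bdd that])
  have nn: "0 \<le> \<phi> x" for x unfolding \<phi>_def by (rule cINF_greatest[OF False]) simp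
  have lip: "\<phi> x \<le> \<phi> y + d x y" if "x \<in> M" "y \<in> M" for x y
  proof -
    have "\<phi> x - d x y \<le> \<phi> y"
      unfolding \<phi>_def[of y]
    proof (rule cINF_greatest[OF False])
      fix a assume a: "a \<in> C"
      have "d x a \<le> d x y + d y a" using triangle that a CM by blast
      then show "\<phi> x - d x y \<le> d y a" using le[OF a, of x] by linarith
    qed
    then show ?thesis by linarith
  qed
  have "continuous_map mtopology (Met_TC.mtopology) \<phi>"
  proof -
    have "\<exists>\<delta>>0. \<forall>x. x \<in> M \<and> d a x < \<delta> \<longrightarrow> dist (\<phi> a) (\<phi> x) < \<epsilon>" if "a \<in> M" "\<epsilon> > 0" for a \<epsilon>
    proof (intro exI[of _ \<epsilon>] conjI allI impI)
      fix x assume x: "x \<in> M \<and> d a x < \<epsilon>"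
      then show "dist (\<phi> a) (\<phi> x) < \<epsilon>"
        using lip[of a x] lip[of x a] that commute[of a x] unfolding dist_real_def by linarith
    qed (use that in simp)
    then show ?thesis using metric_continuous_map[OF Met_TC.Metric_space_axioms, of \<phi>] by auto
  qed
  then have "continuous_map mtopology euclideanreal \<phi>" by simp
  moreover have "\<phi> x = 0 \<longleftrightarrow> x \<in> C" if x: "x \<in> M" for x
  proof
    assume 0: "\<phi> x = 0"
    show "x \<in> C"
    proof (rule ccontr)
      assume "x \<notin> C"
      then have "x \<in> M - C" "openin mtopology (M - C)" using x C by auto
      then obtain r where r: "r > 0" "mball x r \<subseteq> M - C" unfolding openin_mtopology by blast
      have "r \<le> \<phi> x" unfolding \<phi>_def
      proof (rule cINF_greatest[OF False])
        fix a assume "a \<in> C"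
        then have "a \<notin> mball x r" "a \<in> M" using r CM by auto
        then show "r \<le> d x a" using x by simp
      qed
      then show False using 0 r by simp
    qed
  next
    assume xC: "x \<in> C"
    then show "\<phi> x = 0" using le[OF xC, of x] nn[of x] x by simp
  qed
  ultimately show ?thesis using that nn by blast
qed

lemma compactin_positive_lower_bound:
  assumes "compactin X K" "continuous_map X euclideanreal \<phi>" "\<And>x. x \<in> K \<Longrightarrow> 0 < \<phi> x"
  obtains c where "c > 0" "\<And>x. x \<in> K \<Longrightarrow> c \<le> \<phi> x"
proof (cases "K = {}")
  case False
  have "compact (\<phi> ` K)" using image_compactin[OF assms(1,2)] by simp
  then obtain s where "s \<in> \<phi> ` K" "\<forall>t\<in>\<phi> ` K. s \<le> t" using compact_attains_inf False by blast
  then show ?thesis using that[of s] assms(3) by auto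
qed (use that[of 1] in auto)

lemma continuous_map_scaleR_const:
  fixes p :: "'v::real_normed_vector"
  assumes "continuous_map X euclideanreal \<phi>"
  shows "continuous_map X euclidean (\<lambda>x. \<phi> x *\<^sub>R p)"
  using assms unfolding continuous_map_atin by (auto intro!: tendsto_intros)

lemma continuous_map_dist:
  fixes g h :: "'a \<Rightarrow> 'v::real_normed_vector"
  assumes "continuous_map X euclidean g" "continuous_map X euclidean h"
  shows "continuous_map X euclideanreal (\<lambda>x. dist (g x) (h x))"
  using assms unfolding continuous_map_atin by (auto intro!: tendsto_intros)

lemma openin_Collect_less:
  assumes "continuous_map X euclideanreal \<phi>" "continuous_map X euclideanreal \<psi>"
  shows "openin X {x \<in> topspace X. \<phi> x < \<psi> x}"
proof -
  have "continuous_map X euclideanreal (\<lambda>x. \<psi> x - \<phi> x)" using assms by (intro continuous_map_diff)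
  then have "openin X {x \<in> topspace X. \<psi> x - \<phi> x \<in> {0<..}}"
    by (rule openin_continuous_map_preimage) simp
  then show ?thesis by simp
qed

text \<open>The cover serves both aims: its members are so small that points \<open>e\<close> apart
  share none, which makes their carriers disjoint, and \<open>h\<close> varies little on each, which
  makes the barycentric map close to \<open>h\<close>.\<close>

lemma (in Metric_space) approximate_on_compact:
  fixes h :: "'a \<Rightarrow> 'v::euclidean_space"
  assumes K: "compactin mtopology K" and dimK: "covering_dim_le (subtopology mtopology K) (int n)"
    and h: "continuous_map mtopology euclidean h" and c: "c > 0" and e: "e > 0" and dim: "2 * n + 1 \<le> DIM('v)"
  obtains g where "continuous_map mtopology euclidean g" "\<And>x. x \<in> K \<Longrightarrow> dist (g x) (h x) < c"
    "\<And>z. finite (secant_dirs d K g z e)"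
proof -
  have KM: "K \<subseteq> M" using compactin_subset_topspace[OF K] by simp
  define W where "W a = mball a (e/2) \<inter> {x \<in> M. dist (h x) (h a) < c/2}" for a
  have W: "openin mtopology (W a)" "a \<in> M \<Longrightarrow> a \<in> W a" for a
  proof -
    have "openin mtopology {x \<in> topspace mtopology. dist (h x) (h a) < c/2}"
      by (intro openin_Collect_less continuous_map_dist h) auto
    then show "openin mtopology (W a)" unfolding W_def by auto
    show "a \<in> M \<Longrightarrow> a \<in> W a" using c e by (simp add: W_def)
  qed
  have "\<exists>\<F>. finite \<F> \<and> \<F> \<subseteq> W ` K \<and> K \<subseteq> \<Union>\<F>"
  proof (rule compactinD[OF K])
    show "openin mtopology U" if "U \<in> W ` K" for U using that W(1) by blast
    show "K \<subseteq> \<Union>(W ` K)" using W(2) KM by blast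
  qed
  then obtain \<F> where F: "finite \<F>" "\<F> \<subseteq> W ` K" "K \<subseteq> \<Union>\<F>" by blast
  have tK: "topspace (subtopology mtopology K) = K" using KM by (simp add: topspace_subtopology Int_absorb1)
  define \<U> where "\<U> = (\<lambda>U. K \<inter> U) ` \<F>"
  have "finite \<U> \<and> (\<forall>U\<in>\<U>. openin (subtopology mtopology K) U) \<and> \<Union>\<U> = topspace (subtopology mtopology K)"
    using F W(1) unfolding tK \<U>_def by (auto simp: openin_subtopology_Int2)
  then obtain \<V> where *: "finite \<V> \<and> (\<forall>V\<in>\<V>. openin (subtopology mtopology K) V) \<and>
     \<Union>\<V> = topspace (subtopology mtopology K) \<and> (\<forall>V\<in>\<V>. \<exists>U\<in>\<U>. V \<subseteq> U) \<and>
     (\<forall>x\<in>topspace (subtopology mtopology K). int (card {V\<in>\<V>. x \<in> V}) \<le> int n + 1)"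
    using dimK unfolding covering_dim_le_def by presburger
  have "card {V\<in>\<V>. x \<in> V} \<le> n + 1" if "x \<in> K" for x
  proof -
    have "int (card {V\<in>\<V>. x \<in> V}) \<le> int n + 1" using * that unfolding tK by blast
    then show ?thesis by linarith
  qed
  with * have V: "finite \<V>" "\<And>V. V \<in> \<V> \<Longrightarrow> openin (subtopology mtopology K) V" "\<Union>\<V> = K"
     "\<And>V. V \<in> \<V> \<Longrightarrow> \<exists>U\<in>\<U>. V \<subseteq> U" "\<And>x. x \<in> K \<Longrightarrow> card {V\<in>\<V>. x \<in> V} \<le> n + 1"
    unfolding tK by meson+
  have "\<exists>a\<in>K. V \<subseteq> W a" if "V \<in> \<V>" for V
    using V(4)[OF that] F(2) unfolding \<U>_def by blast
  then obtain a where a: "\<And>V. V \<in> \<V> \<Longrightarrow> a V \<in> K" "\<And>V. V \<in> \<V> \<Longrightarrow> V \<subseteq> W (a V)" by metis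
  obtain p where p: "\<And>V. V \<in> \<V> \<Longrightarrow> dist (p V) (h (a V)) < c/2" "in_general_position \<V> p"
    using general_position_dense[OF V(1), of "c/2" "\<lambda>V. h (a V)"] c by auto
  \<comment> \<open>\<open>V\<close> is open only in \<open>K\<close>, so the zero set is
    \<open>K - V\<close>, which is closed in the whole space. The function is thus positive off
    \<open>K\<close>; carriers are read off on \<open>K\<close> only.\<close>
  have "\<exists>\<phi>. continuous_map mtopology euclideanreal \<phi> \<and> (\<forall>x\<in>M. 0 \<le> \<phi> x \<and> (\<phi> x = 0 \<longleftrightarrow> x \<in> K - V))"
    if "V \<in> \<V>" for V
  proof -
    have "closedin mtopology K" using K Hausdorff_space_mtopology compactin_imp_closedin by blast
    moreover have "closedin (subtopology mtopology K) (K - V)"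
      using closedin_diff[OF closedin_topspace V(2)[OF that]] by (simp only: tK)
    ultimately have "closedin mtopology (K - V)" using closedin_trans_full by blast
    then show ?thesis using zero_set_function by metis
  qed
  then obtain \<psi> where \<psi>: "\<And>V. V \<in> \<V> \<Longrightarrow> continuous_map mtopology euclideanreal (\<psi> V)"
    "\<And>V x. V \<in> \<V> \<Longrightarrow> x \<in> M \<Longrightarrow> 0 \<le> \<psi> V x" "\<And>V x. V \<in> \<V> \<Longrightarrow> x \<in> M \<Longrightarrow> \<psi> V x = 0 \<longleftrightarrow> x \<in> K - V"
    by metis
  define \<sigma> where "\<sigma> x = (\<Sum>V\<in>\<V>. \<psi> V x)" for x
  have \<sigma>: "continuous_map mtopology euclideanreal \<sigma>"
    unfolding \<sigma>_def using V(1) \<psi>(1) by (intro continuous_map_sum) auto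
  have "0 < \<sigma> x" if x: "x \<in> K" for x
  proof -
    obtain V0 where V0: "V0 \<in> \<V>" "x \<in> V0" using V(3) x by blast
    have xM: "x \<in> M" using x KM by blast
    have "0 < \<psi> V0 x" using \<psi>(2,3)[OF V0(1) xM] V0(2) by (simp add: less_le)
    then show ?thesis unfolding \<sigma>_def using V(1) \<psi>(2) xM V0(1) by (intro sum_pos2) auto
  qed
  then obtain \<kappa> where \<kappa>: "\<kappa> > 0" "\<And>x. x \<in> K \<Longrightarrow> \<kappa> \<le> \<sigma> x"
    using compactin_positive_lower_bound[OF K \<sigma>] by blast
  \<comment> \<open>The maximum equals \<open>\<sigma> x\<close> on \<open>K\<close> and keeps the
    denominator positive elsewhere, so \<open>g\<close> is continuous on the whole space while the
    weights sum to 1 on \<open>K\<close>.\<close>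
  define l where "l x V = \<psi> V x / max \<kappa> (\<sigma> x)" for x V
  define g where "g x = (\<Sum>V\<in>\<V>. l x V *\<^sub>R p V)" for x
  have "continuous_map mtopology euclidean g"
    unfolding g_def l_def using V(1) \<psi>(1) \<sigma> \<kappa>(1)
    by (intro continuous_map_sum continuous_map_scaleR_const continuous_map_real_divide continuous_map_real_max) auto
  moreover have l1: "sum (l x) \<V> = 1" if x: "x \<in> K" for x
  proof -
    have "sum (l x) \<V> = \<sigma> x / max \<kappa> (\<sigma> x)" by (simp add: l_def \<sigma>_def sum_divide_distrib)
    then show ?thesis using \<kappa>(1) \<kappa>(2)[OF x] by (simp add: max_def)
  qed
  have supp: "{V\<in>\<V>. l x V \<noteq> 0} = {V\<in>\<V>. x \<in> V}" if x: "x \<in> K" for x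
    using \<psi>(3) \<kappa>(1) x KM by (auto simp: l_def max_def)
  have near: "dist (g x) (h x) < c" if x: "x \<in> K" for x
  proof -
    let ?T = "{V\<in>\<V>. x \<in> V}"
    have off: "l x V = 0" if "V \<in> \<V> - ?T" for V using supp[OF x] that by blast
    \<comment> \<open>Balls are convex, and each vertex with nonzero weight lies within
      \<open>c\<close> of \<open>h x\<close>: half comes from the perturbation of the vertex, half
      from the variation of \<open>h\<close> on \<open>V\<close>.\<close>
    have "(\<Sum>V\<in>?T. l x V *\<^sub>R p V) \<in> ball (h x) c"
    proof (rule convex_sum)
      show "sum (l x) ?T = 1"
        using l1[OF x] sum.mono_neutral_right[of \<V> ?T "l x"] V(1) off by auto
      fix V assume "V \<in> ?T"
      then have V: "V \<in> \<V>" "x \<in> V" by auto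
      show "0 \<le> l x V" using \<psi>(2)[OF V(1)] x KM \<kappa>(1) by (auto simp: l_def)
      have "x \<in> W (a V)" using a(2)[OF V(1)] V(2) by blast
      then have "dist (h x) (h (a V)) < c/2" by (simp add: W_def)
      then show "p V \<in> ball (h x) c"
        using p(1)[OF V(1)] dist_triangle2[of "h x" "p V" "h (a V)"] by simp
    qed (use V(1) in auto)
    moreover have "g x = (\<Sum>V\<in>?T. l x V *\<^sub>R p V)"
      unfolding g_def using V(1) off by (intro sum.mono_neutral_right) auto
    ultimately show ?thesis by (simp add: dist_commute)
  qed
  moreover have "finite (secant_dirs d K g z e)" for z
  proof (rule finite_secant_dirs[OF p(2) V(1) dim e, where l = l])
    show "card {V\<in>\<V>. l x V \<noteq> 0} \<le> n + 1" if "x \<in> K" for x using V(5) supp that by simp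
    show "{V\<in>\<V>. l x V \<noteq> 0} \<inter> {V\<in>\<V>. l x' V \<noteq> 0} = {}" if x: "x \<in> K" "x' \<in> K" "e \<le> d x x'" for x x'
    proof (rule ccontr)
      assume "\<not> ?thesis"
      then obtain V where V: "V \<in> \<V>" "x \<in> V" "x' \<in> V" using supp x by auto
      then have "x \<in> W (a V)" "x' \<in> W (a V)" using a by blast+
      then have "d (a V) x < e/2" "d (a V) x' < e/2" by (auto simp: W_def)
      moreover have "d x x' \<le> d (a V) x + d (a V) x'"
        using triangle''[of x "a V" x'] a(1)[OF V(1)] x KM by blast
      ultimately show False using x(3) by linarith
    qed
  qed (use l1 g_def in auto)
  ultimately show ?thesis using that by blast
qed

section \<open>Elementary properties of \<open>wide\<close> and \<open>secant_dirs\<close>\<close>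

lemma finite_not_wide:
  assumes "finite S" "e > 0"
  shows "\<not> wide S e"
proof
  assume "wide S e"
  then obtain C p q where C: "C \<subseteq> S" "connected C" "p \<in> C" "q \<in> C" "e \<le> dist p q" by (auto simp: wide_def)
  then have "finite C" using assms finite_subset by blast
  then have "C = {} \<or> (\<exists>a. C = {a})" using C(2) connected_finite_iff_sing by blast
  then have "p = q" using C by auto
  then show False using C assms by simp
qed

lemma secant_dirs_cong:
  assumes "\<And>x. x \<in> K \<Longrightarrow> g x = g' x"
  shows "secant_dirs d K g z e = secant_dirs d K g' z e"
  unfolding secant_dirs_def by (intro Collect_cong conj_cong refl bex_cong) (simp_all add: assms)

lemma secant_dirs_mono:
  assumes "e' \<le> e"
  shows "secant_dirs d K g z e \<subseteq> secant_dirs d K g z e'"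
proof
  fix u assume "u \<in> secant_dirs d K g z e"
  then obtain x x' where "norm u = 1" "x \<in> K" "x' \<in> K" "e \<le> d x x'" "e \<le> dist (g x) z" "e \<le> dist (g x') z"
     "g x - z = ((g x - z) \<bullet> u) *\<^sub>R u" "g x' - z = ((g x' - z) \<bullet> u) *\<^sub>R u"
    unfolding secant_dirs_def by blast
  moreover from this assms have "e' \<le> d x x'" "e' \<le> dist (g x) z" "e' \<le> dist (g x') z"
    by linarith+
  ultimately show "u \<in> secant_dirs d K g z e'" unfolding secant_dirs_def by blast
qed

subsection \<open>Tame maps\<close>

context perfect_metric_map begin

text \<open>The predicate \<open>A\<close> selects the points \<open>z\<close> to be tested: all of
  them for density, those away from the graph for the G-delta part.\<close>

definition tame :: "(('a \<Rightarrow> 'v) \<Rightarrow> 'b \<Rightarrow> 'v \<Rightarrow> bool) \<Rightarrow> ('a \<Rightarrow> 'v::euclidean_space) \<Rightarrow> 'b \<Rightarrow> real \<Rightarrow> bool" where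
  "tame A g y e \<longleftrightarrow> (\<forall>z. norm z \<le> inverse e \<longrightarrow> A g y z \<longrightarrow> \<not> wide (secant_dirs dX (fib y) g z e) e)"

abbreviation "tame_all \<equiv> tame (\<lambda>_ _ _. True)"

text \<open>The distance of \<open>z\<close> is taken from the graph of \<open>(f, g)\<close> over all of \<open>X\<close> and not from
  \<open>g ` fib y\<close> alone: as \<open>f\<close> need not be open, only the former bound survives limits in \<open>y\<close>.\<close>

definition off_graph :: "real \<Rightarrow> ('a \<Rightarrow> 'v::euclidean_space) \<Rightarrow> 'b \<Rightarrow> 'v \<Rightarrow> bool" where
  "off_graph e g y z \<longleftrightarrow> (\<forall>x\<in>MX. e \<le> dY (f x) y \<or> e \<le> dist (g x) z)"

text \<open>The compactness argument shared by both versions of tameness: counterexamples at radii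
  \<open>1/(i+1)\<close> converge to a wide set for \<open>g\<close> itself. What remains of
  \<open>A\<close> in the limit is left to the hypothesis \<open>limit\<close>.\<close>

lemma tame_nearby_of_limit:
  fixes g :: "'a \<Rightarrow> 'v::euclidean_space"
  assumes g: "continuous_map X.mtopology euclidean g" and y: "y \<in> MY"
    and limit: "\<And>ys gs zs z. \<lbrakk>\<And>i. dY y (ys i) < inverse (Suc i);
      \<And>i x. x \<in> fib y \<Longrightarrow> dist (gs i x) (g x) < inverse (Suc i); \<And>i. A (gs i) (ys i) (zs i); zs \<longlonglongrightarrow> z;
      norm z \<le> inverse e; wide (secant_dirs dX (fib y) g z e) e\<rbrakk> \<Longrightarrow> False"
  shows "\<exists>r>0. r \<le> 1 \<and> (\<forall>g' y'. y' \<in> MY \<longrightarrow> dY y y' < r \<longrightarrow>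
      (\<forall>x\<in>MX. dY y (f x) < r \<longrightarrow> dist (g' x) (g x) < r) \<longrightarrow>
      tame A g' y' e)"
proof (rule ccontr)
  assume neg: "\<not> ?thesis"
  have "\<exists>g' y' z. y' \<in> MY \<and> dY y y' < inverse (Suc i) \<and>
      (\<forall>x\<in>MX. dY y (f x) < inverse (Suc i) \<longrightarrow> dist (g' x) (g x) < inverse (Suc i)) \<and>
      norm z \<le> inverse e \<and> A g' y' z \<and> wide (secant_dirs dX (fib y') g' z e) e" for i :: nat
  proof (rule ccontr)
    assume "\<not> ?thesis"
    moreover have "inverse (real (Suc i)) > 0" "inverse (real (Suc i)) \<le> 1" by (auto simp: inverse_le_1_iff)
    ultimately show False using neg unfolding tame_def by blast
  qed
  then obtain gs ys zs where s: "\<And>i. ys i \<in> MY" "\<And>i. dY y (ys i) < inverse (Suc i)"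
     "\<And>i x. x \<in> MX \<Longrightarrow> dY y (f x) < inverse (Suc i) \<Longrightarrow> dist (gs i x) (g x) < inverse (Suc i)"
     "\<And>i. norm (zs i) \<le> inverse e" "\<And>i. A (gs i) (ys i) (zs i)"
     "\<And>i. wide (secant_dirs dX (fib (ys i)) (gs i) (zs i) e) e" by metis
  have s': "dist (gs i x) (g x) < inverse (Suc i)" if "x \<in> fib (ys i)" for i x
    using that s(2)[of i] s(3)[of x i] by (auto simp: fib_def)
  then obtain z r where z: "strict_mono r" "(zs \<circ> r) \<longlonglongrightarrow> z" "norm z \<le> inverse e" "wide (secant_dirs dX (fib y) g z e) e"
    using wide_subsequence[OF g y s(1,2) s' s(4,6)] by blast
  \<comment> \<open>Since \<open>r i \<ge> i\<close>, the bounds survive the passage to the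
    subsequence.\<close>
  have dec: "inverse (Suc (r i)) \<le> inverse (Suc i)" for i
    using seq_suble[OF z(1), of i] by simp
  show False
  proof (rule limit[of "ys \<circ> r" "gs \<circ> r" "zs \<circ> r"])
    show "dY y ((ys \<circ> r) i) < inverse (Suc i)" for i
      using s(2)[of "r i"] dec[of i] unfolding o_def by linarith
    show "dist ((gs \<circ> r) i x) (g x) < inverse (Suc i)" if "x \<in> fib y" for i x
    proof -
      have "x \<in> MX" "dY y (f x) < inverse (Suc (r i))" using that y by (auto simp: fib_def)
      then show ?thesis using s(3)[of x "r i"] dec[of i] unfolding o_def by linarith
    qed
  qed (use z s(5) in auto)
qed

lemma tame_all_nearby:
  assumes g: "continuous_map X.mtopology euclidean (g :: 'a \<Rightarrow> 'v::euclidean_space)"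
    and y: "y \<in> MY" and t: "tame_all g y e"
  shows "\<exists>r>0. r \<le> 1 \<and> (\<forall>g' y'. y' \<in> MY \<longrightarrow> dY y y' < r \<longrightarrow>
      (\<forall>x\<in>MX. dY y (f x) < r \<longrightarrow> dist (g' x) (g x) < r) \<longrightarrow> tame_all g' y' e)"
proof (rule tame_nearby_of_limit[OF g y])
  fix z assume "norm z \<le> inverse e" "wide (secant_dirs dX (fib y) g z e) e"
  then show False using t by (auto simp: tame_def)
qed

lemma tame_off_graph_nearby:
  assumes g: "continuous_map X.mtopology euclidean (g :: 'a \<Rightarrow> 'v::euclidean_space)"
    and y: "y \<in> MY" and e: "e > 0"
    and t: "\<And>z. z \<notin> g ` fib y \<Longrightarrow> \<not> wide (secant_dirs dX (fib y) g z e) e"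
  shows "\<exists>r>0. r \<le> 1 \<and> (\<forall>g' y'. y' \<in> MY \<longrightarrow> dY y y' < r \<longrightarrow>
      (\<forall>x\<in>MX. dY y (f x) < r \<longrightarrow> dist (g' x) (g x) < r) \<longrightarrow> tame (off_graph e) g' y' e)"
proof (rule tame_nearby_of_limit[OF g y])
  fix ys and gs :: "nat \<Rightarrow> 'a \<Rightarrow> 'v" and zs z
  assume ys: "\<And>i. dY y (ys i) < inverse (Suc i)"
    and gs: "\<And>i x. x \<in> fib y \<Longrightarrow> dist (gs i x) (g x) < inverse (Suc i)"
    and A: "\<And>i. off_graph e (gs i) (ys i) (zs i)"
    and z: "zs \<longlonglongrightarrow> z" and w: "wide (secant_dirs dX (fib y) g z e) e"
  have "e \<le> dist (g x) z" if x: "x \<in> fib y" for x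
  proof (rule tendsto_lowerbound)
    have "(\<lambda>i. gs i x - g x) \<longlonglongrightarrow> 0"
    proof (rule Lim_null_comparison[OF _ LIMSEQ_inverse_real_of_nat])
      show "\<forall>\<^sub>F i in sequentially. norm (gs i x - g x) \<le> inverse (real (Suc i))"
        using gs[OF x] by (intro always_eventually allI) (metis dist_norm less_imp_le)
    qed
    then have "(\<lambda>i. gs i x) \<longlonglongrightarrow> g x" by (simp add: LIM_zero_iff)
    then show "(\<lambda>i. dist (gs i x) (zs i)) \<longlonglongrightarrow> dist (g x) z" using z by (rule tendsto_dist)
    obtain N where N: "inverse (Suc N) < e" using reals_Archimedean[OF e] by blast
    have "e \<le> dist (gs i x) (zs i)" if "i \<ge> N" for i
    proof -
      have "inverse (Suc i) \<le> inverse (Suc N)" using that by simp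
      then have "dY y (ys i) < e" using ys[of i] N by linarith
      then have "dY (f x) (ys i) < e" using x by (simp add: fib_def)
      then show ?thesis using A[of i] x unfolding off_graph_def fib_def by (smt (verit) mem_Collect_eq)
    qed
    then show "\<forall>\<^sub>F i in sequentially. e \<le> dist (gs i x) (zs i)" by (auto simp: eventually_sequentially)
  qed simp
  then have "z \<notin> g ` fib y" using e by force
  then show False using t w by blast
qed

text \<open>A good approximation on one fibre stays tame over a neighbourhood of \<open>y\<close>,
  and stays \<open>\<epsilon>\<close>-close to \<open>h\<close> over one because \<open>f\<close> is
  closed. One of these maps is then selected for each fibre by a locally constant choice.\<close>

lemma tame_dense:
  fixes h :: "'a \<Rightarrow> 'v::euclidean_space"
  assumes dimf: "\<And>y. y \<in> MY \<Longrightarrow> covering_dim_le (subtopology X.mtopology (fib y)) (int n)"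
    and sep: "clopen_separated Y.mtopology" and dim: "2 * n + 1 \<le> DIM('v)" and e: "e > 0"
    and h: "h \<in> maps_into X.mtopology" and \<epsilon>: "gauge_fun X.mtopology \<epsilon>"
  shows "\<exists>g\<in>source_ball X.mtopology h \<epsilon>. \<forall>y\<in>MY. tame_all g y e"
proof -
  have ch: "continuous_map X.mtopology euclidean h" using h by (simp add: maps_into_def)
  have c\<epsilon>: "continuous_map X.mtopology euclideanreal \<epsilon>" and pos: "\<And>x. x \<in> MX \<Longrightarrow> 0 < \<epsilon> x"
    using \<epsilon> by (auto simp: gauge_fun_def)
  define \<Phi> where "\<Phi> y g r \<longleftrightarrow> r > (0::real) \<and> continuous_map X.mtopology euclidean g \<and>
      (\<forall>x\<in>MX. dY y (f x) < r \<longrightarrow> dist (g x) (h x) < \<epsilon> x) \<and> (\<forall>y'\<in>MY. dY y y' < r \<longrightarrow> tame_all g y' e)"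
    for y g r
  have "\<exists>g r. \<Phi> y g r" if y: "y \<in> MY" for y
  proof -
    obtain c where c: "c > 0" "\<And>x. x \<in> fib y \<Longrightarrow> c \<le> \<epsilon> x"
      using compactin_positive_lower_bound[OF fib_compact[of y] c\<epsilon>] pos by (auto simp: fib_def)
    obtain g where g: "continuous_map X.mtopology euclidean g" "\<And>x. x \<in> fib y \<Longrightarrow> dist (g x) (h x) < c"
      "\<And>z. finite (secant_dirs dX (fib y) g z e)"
      using X.approximate_on_compact[OF fib_compact dimf[OF y] ch c(1) e dim] by blast
    have "tame_all g y e" using g(3) e finite_not_wide by (auto simp: tame_def)
    then obtain r1 where r1: "r1 > 0" "\<And>g' y'. y' \<in> MY \<Longrightarrow> dY y y' < r1 \<Longrightarrow>
      (\<forall>x\<in>MX. dY y (f x) < r1 \<longrightarrow> dist (g' x) (g x) < r1) \<Longrightarrow> tame_all g' y' e"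
      using tame_all_nearby[OF g(1) y] by blast
    have o: "openin X.mtopology {x \<in> topspace X.mtopology. dist (g x) (h x) < \<epsilon> x}"
      by (intro openin_Collect_less continuous_map_dist g(1) ch c\<epsilon>)
    have "fib y \<subseteq> {x \<in> topspace X.mtopology. dist (g x) (h x) < \<epsilon> x}"
      using g(2) c(2) by (fastforce simp: fib_def)
    then obtain r2 where r2: "r2 > 0" "\<And>x. x \<in> MX \<Longrightarrow> dY y (f x) < r2 \<Longrightarrow> dist (g x) (h x) < \<epsilon> x"
      using fibre_neighbourhood[OF o y] by auto
    show ?thesis
      unfolding \<Phi>_def using g(1) r1 r2 by (intro exI[of _ g] exI[of _ "min r1 r2"]) auto
  qed
  then obtain G R where "\<And>y. y \<in> MY \<Longrightarrow> \<Phi> y (G y) (R y)" by metis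
  then have GR: "\<And>y. y \<in> MY \<Longrightarrow> R y > (0::real)"
    "\<And>y. y \<in> MY \<Longrightarrow> continuous_map X.mtopology euclidean (G y)"
    "\<And>y x. y \<in> MY \<Longrightarrow> x \<in> MX \<Longrightarrow> dY y (f x) < R y \<Longrightarrow> dist (G y x) (h x) < \<epsilon> x"
    "\<And>y y'. y \<in> MY \<Longrightarrow> y' \<in> MY \<Longrightarrow> dY y y' < R y \<Longrightarrow> tame_all (G y) y' e"
    unfolding \<Phi>_def by blast+
  obtain c where c: "\<And>y. y \<in> MY \<Longrightarrow> c y \<in> MY" "\<And>y. y \<in> MY \<Longrightarrow> y \<in> Y.mball (c y) (R (c y))"
    "\<And>s. openin Y.mtopology {y \<in> MY. c y = s}"
    using Y.clopen_separated_disjoint_refinement[OF sep, of "\<lambda>y. Y.mball y (R y)"] GR(1) by auto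
  \<comment> \<open>The selection depends on \<open>f x\<close> only, so on each whole fibre
    \<open>g\<close> is one of the maps \<open>G s\<close> and has the same secants there.\<close>
  define g where "g = restrict (\<lambda>x. G (c (f x)) x) MX"
  have "continuous_map X.mtopology euclidean g"
  proof (rule pasting_lemma[where I = MY and T = "\<lambda>s. {x \<in> MX. c (f x) = s}" and f = G])
    fix s
    have "openin X.mtopology {x \<in> topspace X.mtopology. f x \<in> {y \<in> MY. c y = s}}"
      using openin_continuous_map_preimage[OF cont c(3)] .
    moreover have "{x \<in> topspace X.mtopology. f x \<in> {y \<in> MY. c y = s}} = {x \<in> MX. c (f x) = s}"
      using f_in by auto
    ultimately show "openin X.mtopology {x \<in> MX. c (f x) = s}" by simp
  qed (use GR(2) c(1) f_in in \<open>auto simp: g_def intro: continuous_map_from_subtopology\<close>)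
  then have "g \<in> maps_into X.mtopology" by (simp add: maps_into_def g_def)
  moreover have "dist (g x) (h x) < \<epsilon> x" if x: "x \<in> MX" for x
    using GR(3)[OF c(1)[OF f_in[OF x]] x] c(2)[OF f_in[OF x]] x by (simp add: g_def)
  moreover have "tame_all g y e" if y: "y \<in> MY" for y
  proof -
    have "tame_all (G (c y)) y e" using GR(4)[OF c(1)[OF y] y] c(2)[OF y] by simp
    moreover have "secant_dirs dX (fib y) g z e = secant_dirs dX (fib y) (G (c y)) z e" for z
      by (rule secant_dirs_cong) (auto simp: g_def fib_def)
    ultimately show ?thesis by (simp add: tame_def)
  qed
  ultimately show ?thesis by (auto simp: source_ball_def)
qed

section \<open>Tameness and the dimension of the space of secants\<close>

lemma not_wide_of_zero_dim:
  assumes y: "y \<in> MY" and z: "z \<notin> g ` fib y"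
    and dim: "covering_dim (subtopology line_topology (secant_lines (fib y) g z)) \<le> 0"
  shows "\<not> wide (secant_dirs dX (fib y) g z (inverse (Suc k))) (inverse (Suc k))"
proof
  let ?P = "secant_lines (fib y) g z"
  assume "wide (secant_dirs dX (fib y) g z (inverse (Suc k))) (inverse (Suc k))"
  then obtain C p q where C: "C \<subseteq> secant_dirs dX (fib y) g z (inverse (Suc k))" "connected C" "p \<in> C" "q \<in> C"
    "inverse (Suc k) \<le> dist p q" unfolding wide_def by blast
  have "covering_dim_le (subtopology line_topology ?P) 0"
    using dim covering_dim_le_iff[of 0 "subtopology line_topology ?P"] by (simp add: zero_ereal_def)
  then have "clopen_separated (subtopology line_topology ?P)" by (simp add: covering_dim_le_0_iff)
  moreover have "?P \<subseteq> lines" by (auto simp: secant_lines_def)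
  moreover have "C \<subseteq> {u. norm u = 1 \<and> affine hull {z, z + u} \<in> ?P}"
    using C(1) secant_direction_iff[OF X.Metric_space_axioms _ z] by (auto simp: fib_def)
  ultimately have "\<exists>a. C \<subseteq> {a}"
    by (rule connected_directions_of_clopen_separated_lines[OF _ _ C(2)])
  then have "p = q" using C by blast
  moreover have "inverse (real (Suc k)) > 0" by simp
  ultimately show False using C(5) by simp
qed

text \<open>Tameness at one scale allows small connected sets. But the sets \<open>F k\<close>
  increase, so a nondegenerate connected subset of \<open>F j\<close> stays inside
  \<open>F k\<close> for all larger \<open>k\<close> and is wide once the scale is small enough.
  Each \<open>F k\<close> is therefore totally disconnected.\<close>

lemma zero_dim_of_tame_off_graph:
  assumes g: "continuous_map X.mtopology euclidean (g :: 'a \<Rightarrow> 'v::euclidean_space)"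
    and y: "y \<in> MY" and z: "z \<notin> g ` fib y"
    and t: "\<And>k. tame (off_graph (inverse (Suc k))) g y (inverse (Suc k))"
  shows "covering_dim (subtopology line_topology (secant_lines (fib y) g z)) \<le> 0"
proof -
  let ?P = "secant_lines (fib y) g z"
  define D where "D = {u. norm u = 1 \<and> affine hull {z, z + u} \<in> ?P}"
  define F where "F k = secant_dirs dX (fib y) g z (inverse (Suc k))" for k
  have DF: "D = (\<Union>k. F k)"
    using secant_direction_iff[OF X.Metric_space_axioms _ z] by (auto simp: fib_def D_def F_def)
  have mono: "F j \<subseteq> F k" if "j \<le> k" for j k
    unfolding F_def by (rule secant_dirs_mono) (use that in simp)
  have "compactin euclidean (g ` fib y)" using image_compactin[OF fib_compact g] .
  then have "closed (g ` fib y)" by (simp add: compact_imp_closed)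
  then obtain \<rho> where \<rho>: "\<rho> > 0" "\<And>x. x \<in> fib y \<Longrightarrow> \<rho> \<le> dist z (g x)"
    using separate_point_closed[of "g ` fib y" z] z by auto
  \<comment> \<open>The distance of \<open>z\<close> from one fibre has to be spread to the nearby
    fibres, since \<open>off_graph\<close> speaks of the whole graph. Halving \<open>\<rho>\<close>
    makes the condition open.\<close>
  have o: "openin X.mtopology {x \<in> topspace X.mtopology. \<rho> / 2 < dist (g x) z}"
    by (intro openin_Collect_less continuous_map_dist g) auto
  have "fib y \<subseteq> {x \<in> topspace X.mtopology. \<rho> / 2 < dist (g x) z}"
    using \<rho> by (force simp: fib_def dist_commute)
  then obtain r where r: "r > 0" "\<And>x. x \<in> MX \<Longrightarrow> dY y (f x) < r \<Longrightarrow> \<rho> / 2 < dist (g x) z"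
    using fibre_neighbourhood[OF o y] by auto
  have td: "\<exists>a. C \<subseteq> {a}" if C: "C \<subseteq> F j" "connected C" for C j
  proof (rule ccontr)
    assume "\<not> ?thesis"
    then obtain u v where uv: "u \<in> C" "v \<in> C" "u \<noteq> v" by blast
    then have "0 < min (dist u v) (min r (\<rho> / 2))" using r \<rho> by simp
    then obtain k0 where k0: "inverse (Suc k0) < min (dist u v) (min r (\<rho> / 2))"
      using reals_Archimedean by blast
    obtain k1 :: nat where k1: "norm z \<le> real k1" using real_arch_simple by blast
    \<comment> \<open>\<open>j\<close> keeps \<open>C\<close> inside \<open>F k\<close>,
      \<open>k0\<close> brings the scale below the distance of \<open>u\<close> and \<open>v\<close>
      and the clearance from the graph, and \<open>k1\<close> makes \<open>norm z\<close>
      admissible.\<close>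
    define k where "k = max j (max k0 k1)"
    have "inverse (Suc k) \<le> inverse (real (Suc k0))" by (simp add: k_def)
    then have k: "inverse (Suc k) \<le> dist u v" "inverse (Suc k) \<le> r" "inverse (Suc k) \<le> \<rho> / 2"
      using k0 by linarith+
    have "norm z \<le> inverse (inverse (Suc k))" using k1 by (simp add: k_def)
    moreover have "inverse (Suc k) \<le> dY (f x) y \<or> inverse (Suc k) \<le> dist (g x) z" if "x \<in> MX" for x
      using r(2)[OF that] k Y.commute[of "f x" y] by linarith
    moreover have "C \<subseteq> F k" using C(1) mono[of j k] by (auto simp: k_def)
    then have "wide (F k) (inverse (Suc k))" unfolding wide_def using C(2) uv k(1) by blast
    ultimately show False using t[of k] unfolding tame_def off_graph_def F_def by blast
  qed
  have cF: "compact (F k)" for k unfolding F_def by (rule compact_secant_dirs[OF g y])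
  have "clopen_separated (top_of_set D)"
  proof (rule clopen_separated_countable_closed_union[where F = F])
    show "normal_space (top_of_set D)"
      by (intro metrizable_imp_normal_space metrizable_space_subtopology metrizable_space_euclidean)
    fix k
    have FD: "F k \<subseteq> D" using DF by blast
    then show "closedin (top_of_set D) (F k)" using cF by (simp add: closed_subset compact_imp_closed)
    have "subtopology (top_of_set D) (F k) = top_of_set (F k)"
      using FD by (simp add: subtopology_subtopology Int_absorb1)
    then show "clopen_separated (subtopology (top_of_set D) (F k))"
      using compact_totally_disconnected_imp_clopen_separated[OF cF td] by simp
  qed (simp add: DF)
  then have "clopen_separated (subtopology line_topology ?P)"
    unfolding D_def by (intro clopen_separated_lines_of_directions) (auto simp: secant_lines_def)
  then have "covering_dim_le (subtopology line_topology ?P) 0" by (simp add: covering_dim_le_0_iff)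
  then show ?thesis
    using covering_dim_le_iff[of 0 "subtopology line_topology ?P"] by (simp add: zero_ereal_def)
qed

lemma gdelta_dense_zero_dim_secants:
  fixes G :: "('a \<Rightarrow> 'v::euclidean_space) set"
  assumes dimf: "\<And>y. y \<in> MY \<Longrightarrow> covering_dim_le (subtopology X.mtopology (fib y)) (int n)"
    and sep: "clopen_separated Y.mtopology" and dim: "2 * n + 1 \<le> DIM('v)"
    and G: "G = {g \<in> maps_into X.mtopology. \<forall>y\<in>MY. \<forall>z\<in>- (g ` fib y).
      covering_dim (subtopology line_topology (secant_lines (fib y) g z)) \<le> 0}"
  shows "gdelta_in (source_limitation_topology X.mtopology) G"
    and "source_limitation_topology X.mtopology closure_of G = topspace (source_limitation_topology X.mtopology)"
proof -
  let ?C = "source_limitation_topology X.mtopology :: ('a \<Rightarrow> 'v) topology"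
  define e where "e k = inverse (real (Suc k))" for k
  have e: "e k > 0" for k by (simp add: e_def)
  define T where "T k = {g :: 'a \<Rightarrow> 'v. g \<in> maps_into X.mtopology \<and> (\<forall>y\<in>MY. tame (off_graph (e k)) g y (e k))}" for k
  have TG: "(\<Inter>k. T k) \<subseteq> G"
  proof
    fix g assume "g \<in> (\<Inter>k. T k)"
    then have g: "g \<in> maps_into X.mtopology" "\<And>y k. y \<in> MY \<Longrightarrow> tame (off_graph (inverse (Suc k))) g y (inverse (Suc k))"
      by (auto simp: T_def e_def)
    then show "g \<in> G" unfolding G using zero_dim_of_tame_off_graph[of g] by (auto simp: maps_into_def)
  qed
  have GT: "G \<subseteq> ?C interior_of T k" for k
  proof
    fix g assume g: "g \<in> G"
    then have gm: "g \<in> maps_into X.mtopology" by (simp add: G)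
    then have cg: "continuous_map X.mtopology euclidean g" by (simp add: maps_into_def)
    have "\<not> wide (secant_dirs dX (fib y) g z (e k)) (e k)" if "y \<in> MY" "z \<notin> g ` fib y" for y z
      unfolding e_def using g that by (intro not_wide_of_zero_dim) (auto simp: G)
    then obtain \<epsilon> where \<epsilon>: "gauge_fun X.mtopology \<epsilon>"
      "\<And>g' y. g' \<in> source_ball X.mtopology g \<epsilon> \<Longrightarrow> y \<in> MY \<Longrightarrow> tame (off_graph (e k)) g' y (e k)"
      using gauge_of_local_radii[of g "\<lambda>g' y. tame (off_graph (e k)) g' y (e k)"] tame_off_graph_nearby[OF cg _ e] by metis
    have "source_ball X.mtopology g \<epsilon> \<subseteq> T k" using \<epsilon>(2) by (auto simp: T_def source_ball_def)
    moreover have "openin ?C (source_ball X.mtopology g \<epsilon>)" by (rule openin_source_ball[OF gm \<epsilon>(1)])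
    moreover have "g \<in> source_ball X.mtopology g \<epsilon>" using gm \<epsilon>(1) by (auto simp: source_ball_def gauge_fun_def)
    ultimately show "g \<in> ?C interior_of T k" unfolding interior_of_def by blast
  qed
  \<comment> \<open>Openness of \<open>T k\<close> is not claimed: a neighbourhood inside
    \<open>T k\<close> is obtained only around members of \<open>G\<close>. Since the sets
    \<open>T k\<close> also intersect inside \<open>G\<close>, their interiors intersect exactly in
    \<open>G\<close>.\<close>
  have "G = (\<Inter>k. ?C interior_of T k)"
  proof
    have "(\<Inter>k. ?C interior_of T k) \<subseteq> (\<Inter>k. T k)" by (rule INF_superset_mono) (auto simp: interior_of_subset)
    then show "(\<Inter>k. ?C interior_of T k) \<subseteq> G" using TG by (rule order_trans)
  qed (use GT in blast)
  moreover have "gdelta_in ?C (\<Inter>k. ?C interior_of T k)"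
  proof (rule gdelta_in_Inter)
    fix U assume "U \<in> range (\<lambda>k. ?C interior_of T k)"
    then obtain k where U: "U = ?C interior_of T k" by (rule rangeE)
    show "gdelta_in ?C U" unfolding U by (rule open_imp_gdelta_in[OF openin_interior_of])
  qed simp_all
  ultimately show "gdelta_in ?C G" by simp
  \<comment> \<open>The category argument runs on the smaller sets given by \<open>tame_all\<close>,
    which are open and dense; their intersection lies in every \<open>T k\<close>, hence in
    \<open>G\<close>.\<close>
  have dense: "\<exists>g\<in>source_ball X.mtopology h \<epsilon>. g \<in> G" if h: "h \<in> maps_into X.mtopology" "gauge_fun X.mtopology \<epsilon>" for h \<epsilon>
  proof -
    have "\<exists>g\<in>source_ball X.mtopology h \<epsilon>. \<forall>k. g \<in> {g \<in> maps_into X.mtopology. \<forall>y\<in>MY. tame_all g y (e k)}"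
    proof (rule source_limitation_baire[OF _ _ h])
      fix k and g :: "'a \<Rightarrow> 'v" assume "g \<in> {g \<in> maps_into X.mtopology. \<forall>y\<in>MY. tame_all g y (e k)}"
      then have cg: "continuous_map X.mtopology euclidean g" and t: "\<And>y. y \<in> MY \<Longrightarrow> tame_all g y (e k)"
        by (auto simp: maps_into_def)
      obtain \<epsilon> where "gauge_fun X.mtopology \<epsilon>"
        "\<And>g' y. g' \<in> source_ball X.mtopology g \<epsilon> \<Longrightarrow> y \<in> MY \<Longrightarrow> tame_all g' y (e k)"
        using gauge_of_local_radii[of g "\<lambda>g' y. tame_all g' y (e k)"] tame_all_nearby[OF cg _ t] by metis
      then show "\<exists>\<epsilon>. gauge_fun X.mtopology \<epsilon> \<and>
          source_ball X.mtopology g \<epsilon> \<subseteq> {g \<in> maps_into X.mtopology. \<forall>y\<in>MY. tame_all g y (e k)}"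
        by (auto simp: source_ball_def)
    next
      fix k and h :: "'a \<Rightarrow> 'v" and \<epsilon>
      assume "h \<in> maps_into X.mtopology" "gauge_fun X.mtopology \<epsilon>"
      then show "\<exists>g\<in>source_ball X.mtopology h \<epsilon>. g \<in> {g \<in> maps_into X.mtopology. \<forall>y\<in>MY. tame_all g y (e k)}"
        using tame_dense[OF dimf sep dim e, of h \<epsilon> k] by (auto simp: source_ball_def)
    qed
    moreover have "tame_all g y e' \<Longrightarrow> tame (off_graph e') g y e'" for g :: "'a \<Rightarrow> 'v" and y e'
      by (simp add: tame_def)
    then have "g \<in> G" if "\<forall>k. g \<in> {g \<in> maps_into X.mtopology. \<forall>y\<in>MY. tame_all g y (e k)}" for g
      using that TG by (auto simp: T_def)
    ultimately show ?thesis by blast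
  qed
  show "?C closure_of G = topspace ?C"
  proof
    show "topspace ?C \<subseteq> ?C closure_of G"
    proof
      fix h assume h: "h \<in> topspace ?C"
      have "\<exists>g. g \<in> G \<and> g \<in> U" if U: "h \<in> U" "openin ?C U" for U
      proof -
        obtain \<epsilon> where "gauge_fun X.mtopology \<epsilon>" "source_ball X.mtopology h \<epsilon> \<subseteq> U"
          using U unfolding openin_source_limitation_topology by blast
        then show ?thesis using dense[of h \<epsilon>] h by auto
      qed
      then show "h \<in> ?C closure_of G" using h unfolding in_closure_of by blast
    qed
  qed (rule closure_of_subset_topspace)
qed

end

theorem theorem1p2:
  fixes X :: "'a topology" and Y :: "'b topology" and f :: "'a \<Rightarrow> 'b" and n :: nat
  assumes "metrizable_space X" and "metrizable_space Y"
    and "continuous_map X Y f" and "proper_map X Y f"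
    and "map_dim X Y f = ereal (real n)"
    and "covering_dim Y = 0"
    and "CARD('m::finite) \<ge> 2 * n + 1"
  shows "let C = source_limitation_topology X :: ('a \<Rightarrow> real ^ 'm) topology;
             G = {g \<in> maps_into X. \<forall>y \<in> topspace Y.
                   \<forall>z \<in> - (g ` {x \<in> topspace X. f x = y}).
                     covering_dim (subtopology line_topology
                       (secant_lines {x \<in> topspace X. f x = y} g z)) \<le> 0}
         in gdelta_in C G \<and> C closure_of G = topspace C"
proof -
  obtain MX dX where X: "Metric_space MX dX" "X = Metric_space.mtopology MX dX"
    using assms(1) unfolding metrizable_space_def by blast
  obtain MY dY where Y: "Metric_space MY dY" "Y = Metric_space.mtopology MY dY"
    using assms(2) unfolding metrizable_space_def by blast
  interpret perfect_metric_map MX dX MY dY f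
    using X Y assms(3,4) by (simp add: perfect_metric_map_def perfect_metric_map_axioms_def)
  have tX: "topspace X = MX" and tY: "topspace Y = MY" unfolding X(2) Y(2) by simp_all
  have fibre: "{x \<in> topspace X. f x = y} = fib y" for y by (simp add: tX fib_def)
  have "covering_dim_le (subtopology X (fib y)) (int n)" if "y \<in> MY" for y
  proof -
    have "covering_dim (subtopology X (fib y)) \<le> map_dim X Y f"
      unfolding map_dim_def fibre tY using that by (rule SUP_upper)
    then have "covering_dim (subtopology X (fib y)) \<le> ereal (real n)" using assms(5) by simp
    then show ?thesis using covering_dim_le_iff[of "int n" "subtopology X (fib y)"] by simp
  qed
  moreover have "clopen_separated Y"
    using assms(6) covering_dim_le_iff[of 0 Y] by (simp add: zero_ereal_def flip: covering_dim_le_0_iff)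
  moreover have "2 * n + 1 \<le> DIM(real ^ 'm)" using assms(7) by simp
  ultimately show ?thesis
    unfolding Let_def fibre tY
    using gdelta_dense_zero_dim_secants[folded X(2) Y(2), OF _ _ _ refl] by blast
qed

end
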